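(* Let $n\in\mathbb{N}$, let $\mathcal{A}\in\mathcal{M}(n,\infty)$ and let $j_0$ be the number of degenerations of $\mathcal{A}$. Let $\sigma$ be any spectral function of $\mathcal{A}$, with associated initial-condition matrix $\mathscr{T}$ and the vector polynomials $\boldsymbol{p}_k$ ($k\in\mathbb{N}$) and $\boldsymbol{q}_j$ ($1\le j\le j_0$) determined by $\mathcal{A}$ and $\mathscr{T}$. Then: (i) (Nondegenerate case) If $j_0=0$, then for every $n$-dimensional vector polynomial $\boldsymbol{r}$, $$\langle \boldsymbol{r},\boldsymbol{r}\rangle_{L_2(\mathbb{R},\sigma)}=0\iff \boldsymbol{r}\equiv 0 .$$ (ii) (Degenerate case) If $j_0>0$, then $\boldsymbol{q}_1,\dots,\boldsymbol{q}_{j_0}$ are all in the equivalence class of zero of $L_2(\mathbb{R},\sigma)$, and every vector polynomial $\boldsymbol{r}$ in this equivalence class can be written as $$\boldsymbol{r}(z)=\sum_{j=1}^{j_0}R_j(z)\boldsymbol{q}_j(z)$$ with scalar polynomials $R_1,\dots,R_{j_0}$.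
   Context: **The class $\mathcal{M}(n,\infty)$.** It consists of the infinite real symmetric matrices $\mathcal{A}=(a_{kl})_{k,l\ge1}$ with $a_{kl}=0$ for $|k-l|>n$ such that, writing $d_k^{(i)}:=a_{k,k+i}=a_{k+i,k}$ ($0\le i\le n$, $k\ge 1$), there are an integer $0\le j_0\le n-1$ and integers $1<m_1<m_2<\dots<m_{j_0}$ with the following property. Put $m_0:=0$ and $m_{j_0+1}:=\infty$. For every $j\in\{0,\dots,j_0\}$: $d_k^{(n-j)}>0$ for all $k$ with $m_j<k<m_{j+1}$ (a void condition if $m_{j+1}=m_j+1$), and $d_k^{(n-j)}=0$ for all $k\ge m_{j+1}$ (void for $j=j_0$). The numbers $j_0,m_1,\dots,m_{j_0}$ are determined by $\mathcal{A}$; $j_0$ is called the number of degenerations of $\mathcal{A}$. **Vector polynomials.** An $n$-dimensional vector polynomial is $\boldsymbol{r}(z)=(R_1(z),\dots,R_n(z))^t$ with scalar polynomial entries (complex coefficients). Let $\mathscr{T}$ be an $n\times n$ upper triangular matrix with real entries and nonzero diagonal entries. Given $\mathcal{A}\in\mathcal{M}(n,\infty)$ and $\mathscr{T}$, put $\boldsymbol{p}_k:=\mathscr{T}\boldsymbol{e}_k$ for $k=1,\dots,n$ ($\boldsymbol{e}_k$ the canonical basis of $\mathbb{C}^n$) and $\boldsymbol{p}_k:=0$ for $k<1$; for $k>n$ the vector polynomials $\boldsymbol{p}_k(z)$ are the unique ones satisfying $$\sum_{i=0}^{n-1} d_{k-n+i}^{(n-i)}\boldsymbol{p}_{k-n+i}(z)+d_k^{(0)}\boldsymbol{p}_k(z)+\sum_{i=1}^n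 d_k^{(i)}\boldsymbol{p}_{k+i}(z)=z\,\boldsymbol{p}_k(z),\qquad k\in\mathbb{N}\setminus\{m_1,\dots,m_{j_0}\}.$$ For $j=1,\dots,j_0$ put $$\boldsymbol{q}_j(z):=(z-d_{m_j}^{(0)})\boldsymbol{p}_{m_j}(z)-\sum_{k=0}^{n-1}d_{m_j-n+k}^{(n-k)}\boldsymbol{p}_{m_j-n+k}(z)-\sum_{k=1}^{n-j}d_{m_j}^{(k)}\boldsymbol{p}_{m_j+k}(z).$$ **Spectral function.** For a nondecreasing $n\times n$ (Hermitian) matrix-valued function $\sigma$ on $\mathbb{R}$, $L_2(\mathbb{R},\sigma)$ is the usual Hilbert space of (classes of) $\mathbb{C}^n$-valued functions with inner product $\langle f,g\rangle=\int_{\mathbb{R}}\langle f(t),d\sigma(t)g(t)\rangle_{\mathbb{C}^n}$, antilinear in the first argument. A nondecreasing $n\times n$ matrix-valued function $\sigma$ with all moments finite and $\int_{\mathbb{R}}d\sigma$ invertible is called a spectral function of $\mathcal{A}\in\mathcal{M}(n,\infty)$ if there is an $n\times n$ upper triangular matrix $\mathscr{T}$ with real entries and nonzero diagonal entries such that, for the vector polynomials $\boldsymbol{p}_k$ and $\boldsymbol{q}_j$ determined by $\mathcal{A}$ and this $\mathscr{T}$, $\{\boldsymbol{p}_k\}_{k=1}^\infty$ is an orthonormal sequence in $L_2(\mathbb{R},\sigma)$ and, for each $j\in\{1,\dots,j_0\}$, $\boldsymbol{q}_j$ is in the equivalence class of zero of $L_2(\mathbb{R},\sigma)$. *)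

theory Defs
  imports
    "HOL-Analysis.Analysis"
    "Jordan_Normal_Form.Matrix"
    "Jordan_Normal_Form.Schur_Decomposition"
begin

unbundle no vec_syntax

text \<open>
  Infinite matrices are functions \<open>A k l\<close> of which only the entries with \<open>k, l \<ge> 1\<close> matter;
  \<open>diag A i k\<close> is the \<open>k\<close>-th element \<open>a\<^sub>k\<^sub>,\<^sub>k\<^sub>+\<^sub>i\<close> of the \<open>i\<close>-th diagonal.
\<close>

definition diag :: "(nat \<Rightarrow> nat \<Rightarrow> real) \<Rightarrow> nat \<Rightarrow> nat \<Rightarrow> real" where
  "diag A i k = A k (k + i)"

text \<open>
  \<open>band_class n A j\<^sub>0 m\<close>: the matrix \<open>A\<close> belongs to \<open>\<M>(n,\<infinity>)\<close>, with degenerations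
  \<open>m 1 < \<dots> < m j\<^sub>0\<close>. The matrix determines \<open>j\<^sub>0\<close> and these values. The convention
  \<open>m (j\<^sub>0 + 1) = \<infinity>\<close> is rendered by the guards \<open>j < j\<^sub>0\<close>; values \<open>m j\<close> with \<open>j > j\<^sub>0\<close> play no role.
\<close>

definition band_class :: "nat \<Rightarrow> (nat \<Rightarrow> nat \<Rightarrow> real) \<Rightarrow> nat \<Rightarrow> (nat \<Rightarrow> nat) \<Rightarrow> bool" where
  "band_class n A j0 m \<longleftrightarrow>
     1 \<le> n \<and>
     (\<forall>k\<ge>1. \<forall>l\<ge>1. A k l = A l k) \<and>
     (\<forall>k\<ge>1. \<forall>l\<ge>1. \<bar>int k - int l\<bar> > int n \<longrightarrow> A k l = 0) \<and>
     j0 \<le> n - 1 \<and>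
     m 0 = 0 \<and>
     (1 \<le> j0 \<longrightarrow> 1 < m 1) \<and>
     (\<forall>j. 1 \<le> j \<and> j < j0 \<longrightarrow> m j < m (j + 1)) \<and>
     (\<forall>j\<le>j0. \<forall>k. m j < k \<and> (j < j0 \<longrightarrow> k < m (j + 1)) \<longrightarrow> diag A (n - j) k > 0) \<and>
     (\<forall>j<j0. \<forall>k\<ge>m (j + 1). diag A (n - j) k = 0)"

text \<open>
  An \<open>n\<close>-dimensional vector polynomial is an element of \<open>carrier_vec n :: complex poly vec set\<close>.
\<close>

abbreviation real_const :: "real \<Rightarrow> complex poly" where
  "real_const x \<equiv> [:complex_of_real x:]"

abbreviation poly_z :: "complex poly" where
  "poly_z \<equiv> [:0, 1:]"

definition eval_vec :: "complex poly Matrix.vec \<Rightarrow> real \<Rightarrow> complex Matrix.vec" where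
  "eval_vec r t = map_vec (\<lambda>P. poly P (complex_of_real t)) r"

definition initial_matrix :: "nat \<Rightarrow> real mat \<Rightarrow> bool" where
  "initial_matrix n T \<longleftrightarrow>
     T \<in> carrier_mat n n \<and> upper_triangular T \<and> (\<forall>i<n. T $$ (i, i) \<noteq> 0)"

text \<open>
  \<open>vector_polynomials n A j\<^sub>0 m T p\<close>: \<open>p\<close> is the sequence of vector polynomials determined by \<open>A\<close>
  and \<open>T\<close>. The index of \<open>p\<close> starts at 1; since \<open>p 0 = 0\<close>, truncated subtraction in
  \<open>k + i - n\<close> implements the convention that \<open>p\<close> vanishes at all indices below 1. Vectors are
  indexed from 0 in the library, whence \<open>unit_vec n (k - 1)\<close> for the \<open>k\<close>-th basis vector.
\<close>

definition vector_polynomials ::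
  "nat \<Rightarrow> (nat \<Rightarrow> nat \<Rightarrow> real) \<Rightarrow> nat \<Rightarrow> (nat \<Rightarrow> nat) \<Rightarrow> real mat \<Rightarrow>
    (nat \<Rightarrow> complex poly Matrix.vec) \<Rightarrow> bool" where
  "vector_polynomials n A j0 m T p \<longleftrightarrow>
     (\<forall>k. p k \<in> carrier_vec n) \<and>
     p 0 = 0\<^sub>v n \<and>
     (\<forall>k\<in>{1..n}. p k = map_vec real_const (T *\<^sub>v unit_vec n (k - 1))) \<and>
     (\<forall>k\<ge>1. k \<notin> m ` {1..j0} \<longrightarrow>
       (\<forall>c<n.
         (\<Sum>i=0..<n. real_const (diag A (n - i) (k + i - n)) * p (k + i - n) $ c)
           + real_const (diag A 0 k) * p k $ c
           + (\<Sum>i=1..n. real_const (diag A i k) * p (k + i) $ c)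
         = poly_z * p k $ c))"

definition q_poly ::
  "nat \<Rightarrow> (nat \<Rightarrow> nat \<Rightarrow> real) \<Rightarrow> (nat \<Rightarrow> nat) \<Rightarrow> (nat \<Rightarrow> complex poly Matrix.vec) \<Rightarrow>
    nat \<Rightarrow> complex poly Matrix.vec" where
  "q_poly n A m p j = Matrix.vec n (\<lambda>c.
     (poly_z - real_const (diag A 0 (m j))) * p (m j) $ c
       - (\<Sum>k=0..<n. real_const (diag A (n - k) (m j + k - n)) * p (m j + k - n) $ c)
       - (\<Sum>k=1..n - j. real_const (diag A k (m j)) * p (m j + k) $ c))"

definition psd_mat :: "nat \<Rightarrow> complex mat \<Rightarrow> bool" where
  "psd_mat n B \<longleftrightarrow>
     B \<in> carrier_mat n n \<and> mat_adjoint B = B \<and>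
     (\<forall>v\<in>carrier_vec n. 0 \<le> Re ((B *\<^sub>v v) \<bullet>c v))"

definition nondecreasing_mat_fun :: "nat \<Rightarrow> (real \<Rightarrow> complex mat) \<Rightarrow> bool" where
  "nondecreasing_mat_fun n \<sigma> \<longleftrightarrow>
     (\<forall>t. \<sigma> t \<in> carrier_mat n n \<and> mat_adjoint (\<sigma> t) = \<sigma> t) \<and>
     (\<forall>s t. s \<le> t \<longrightarrow> psd_mat n (\<sigma> t - \<sigma> s))"

text \<open>
  No one-sided continuity is imposed on \<open>\<sigma>\<close>. The measure \<open>d\<sigma>\<close> gives the half-open interval
  \<open>{a<..b}\<close> the mass \<open>\<sigma>(b+) - \<sigma>(a+)\<close>, so right limits are taken before passing to
  \<open>interval_measure\<close>, which expects a right-continuous function.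
\<close>

definition right_lim :: "(real \<Rightarrow> 'a::t2_space) \<Rightarrow> real \<Rightarrow> 'a" where
  "right_lim F t = Lim (at_right t) F"

definition trace_measure :: "nat \<Rightarrow> (real \<Rightarrow> complex mat) \<Rightarrow> real measure" where
  "trace_measure n \<sigma> = interval_measure (right_lim (\<lambda>t. \<Sum>i<n. Re (\<sigma> t $$ (i, i))))"

text \<open>
  The matrix measure \<open>d\<sigma>\<close> is absolutely continuous with respect to its trace measure; by the
  Radon-Nikodym theorem a density exists and it is unique almost everywhere, so the choice made in
  \<open>density_mat\<close> affects no integral below: \<open>d\<sigma> = density_mat n \<sigma> d(trace_measure n \<sigma>)\<close>.
\<close>

definition is_density_mat :: "nat \<Rightarrow> (real \<Rightarrow> complex mat) \<Rightarrow> (real \<Rightarrow> complex mat) \<Rightarrow> bool" where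
  "is_density_mat n \<sigma> M \<longleftrightarrow>
     (\<forall>t. M t \<in> carrier_mat n n) \<and>
     (\<forall>i<n. \<forall>j<n.
        (\<lambda>t. M t $$ (i, j)) \<in> borel_measurable borel \<and>
        (\<forall>a b. a \<le> b \<longrightarrow>
           set_integrable (trace_measure n \<sigma>) {a<..b} (\<lambda>t. M t $$ (i, j)) \<and>
           set_lebesgue_integral (trace_measure n \<sigma>) {a<..b} (\<lambda>t. M t $$ (i, j))
             = right_lim (\<lambda>t. \<sigma> t $$ (i, j)) b - right_lim (\<lambda>t. \<sigma> t $$ (i, j)) a))"

definition density_mat :: "nat \<Rightarrow> (real \<Rightarrow> complex mat) \<Rightarrow> real \<Rightarrow> complex mat" where
  "density_mat n \<sigma> = (SOME M. is_density_mat n \<sigma> M)"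

text \<open>
  In the library \<open>v \<bullet>c w\<close> is conjugate-linear in \<open>w\<close>; hence \<open>(M g) \<bullet>c f\<close> is \<open>\<langle>f, M g\<rangle>\<close>, antilinear in
  the first argument \<open>f\<close>.
\<close>

definition L2_inner ::
  "nat \<Rightarrow> (real \<Rightarrow> complex mat) \<Rightarrow> (real \<Rightarrow> complex Matrix.vec) \<Rightarrow>
    (real \<Rightarrow> complex Matrix.vec) \<Rightarrow> complex" where
  "L2_inner n \<sigma> f g =
     integral\<^sup>L (trace_measure n \<sigma>) (\<lambda>t. (density_mat n \<sigma> t *\<^sub>v g t) \<bullet>c f t)"

definition L2_space ::
  "nat \<Rightarrow> (real \<Rightarrow> complex mat) \<Rightarrow> (real \<Rightarrow> complex Matrix.vec) set" where
  "L2_space n \<sigma> = {f.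
     (\<forall>t. f t \<in> carrier_vec n) \<and>
     (\<forall>i<n. (\<lambda>t. f t $ i) \<in> borel_measurable borel) \<and>
     integrable (trace_measure n \<sigma>) (\<lambda>t. (density_mat n \<sigma> t *\<^sub>v f t) \<bullet>c f t)}"

definition L2_zero_class ::
  "nat \<Rightarrow> (real \<Rightarrow> complex mat) \<Rightarrow> (real \<Rightarrow> complex Matrix.vec) set" where
  "L2_zero_class n \<sigma> = {f \<in> L2_space n \<sigma>. L2_inner n \<sigma> f f = 0}"

definition finite_moments :: "nat \<Rightarrow> (real \<Rightarrow> complex mat) \<Rightarrow> bool" where
  "finite_moments n \<sigma> \<longleftrightarrow>
     (\<forall>k::nat. \<forall>i<n. \<forall>j<n.
        integrable (trace_measure n \<sigma>) (\<lambda>t. complex_of_real (t ^ k) * density_mat n \<sigma> t $$ (i, j)))"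

definition total_mass :: "nat \<Rightarrow> (real \<Rightarrow> complex mat) \<Rightarrow> complex mat" where
  "total_mass n \<sigma> =
     mat n n (\<lambda>ij. integral\<^sup>L (trace_measure n \<sigma>) (\<lambda>t. density_mat n \<sigma> t $$ ij))"

text \<open>
  \<open>spectral_function n A j\<^sub>0 m \<sigma> T p\<close>: \<open>\<sigma>\<close> is a spectral function of \<open>A\<close>, witnessed by the
  initial-condition matrix \<open>T\<close> and the vector polynomials \<open>p\<close> that \<open>A\<close> and \<open>T\<close> determine.
\<close>

definition spectral_function ::
  "nat \<Rightarrow> (nat \<Rightarrow> nat \<Rightarrow> real) \<Rightarrow> nat \<Rightarrow> (nat \<Rightarrow> nat) \<Rightarrow> (real \<Rightarrow> complex mat) \<Rightarrow> real mat \<Rightarrow>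
    (nat \<Rightarrow> complex poly Matrix.vec) \<Rightarrow> bool" where
  "spectral_function n A j0 m \<sigma> T p \<longleftrightarrow>
     nondecreasing_mat_fun n \<sigma> \<and>
     finite_moments n \<sigma> \<and>
     invertible_mat (total_mass n \<sigma>) \<and>
     initial_matrix n T \<and>
     vector_polynomials n A j0 m T p \<and>
     (\<forall>k\<ge>1. eval_vec (p k) \<in> L2_space n \<sigma>) \<and>
     (\<forall>k\<ge>1. \<forall>l\<ge>1. L2_inner n \<sigma> (eval_vec (p k)) (eval_vec (p l)) = (if k = l then 1 else 0)) \<and>
     (\<forall>j\<in>{1..j0}. eval_vec (q_poly n A m p j) \<in> L2_zero_class n \<sigma>)"

end

theory Submission
  imports Defs
begin

text \<open>
  The \<open>\<complex>\<close>-span of the \<open>p\<^sub>k\<close> plus the \<open>\<complex>[z]\<close>-span of the \<open>q\<^sub>j\<close> is closed under multiplication by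
  \<open>z\<close>: for \<open>k\<close> not among the \<open>m\<^sub>j\<close> the recurrence expresses \<open>z p\<^sub>k\<close> through the \<open>p\<^sub>l\<close>, and for
  \<open>k = m\<^sub>j\<close> the definition of \<open>q\<^sub>j\<close> does so up to \<open>q\<^sub>j\<close>. As it contains \<open>p\<^sub>1, \<dots>, p\<^sub>n\<close>, the columns of
  the invertible matrix \<open>T\<close>, it consists of all vector polynomials. Thus \<open>r = \<Sum> a\<^sub>k p\<^sub>k + \<Sum> R\<^sub>j q\<^sub>j\<close>;
  the second sum is null because the density of \<open>d\<sigma>\<close> is almost everywhere positive semidefinite and
  therefore annihilates each \<open>q\<^sub>j\<close> almost everywhere. Orthonormality gives
  \<open>\<langle>r, r\<rangle> = \<Sum> \<bar>a\<^sub>k\<bar>\<^sup>2\<close>, so a null \<open>r\<close> has all \<open>a\<^sub>k = 0\<close>. For \<open>j\<^sub>0 = 0\<close> this says \<open>r = 0\<close>.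
\<close>

section \<open>Densities with respect to interval measures\<close>

lemma right_lim_eq:
  fixes F :: "real \<Rightarrow> 'a::t2_space"
  assumes "(F \<longlongrightarrow> l) (at_right t)"
  shows "right_lim F t = l"
  unfolding right_lim_def by (rule tendsto_Lim) (use assms in auto)

text \<open>The limit is the infimum of \<open>F\<close> over \<open>{t<..}\<close>, a set of values
  that monotonicity bounds below by \<open>F t\<close>.\<close>

lemma mono_tendsto_right_lim:
  fixes F :: "real \<Rightarrow> real"
  assumes "mono F"
  shows "(F \<longlongrightarrow> right_lim F t) (at_right t)"
proof -
  have bdd: "bdd_below (F ` {t<..})"
    using assms by (auto intro!: bdd_belowI[of _ "F t"] simp: mono_def)
  have "(F \<longlongrightarrow> Inf (F ` {t<..})) (at_right t)"
  proof (rule order_tendstoI)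
    fix a assume "a < Inf (F ` {t<..})"
    then have "a < F x" if "x > t" for x
      using cInf_lower[OF _ bdd, of "F x"] that by auto
    then show "eventually (\<lambda>x. a < F x) (at_right t)"
      by (auto simp: eventually_at_right_field intro!: exI[of _ "t + 1"])
  next
    fix a assume "Inf (F ` {t<..}) < a"
    then obtain s where s: "s > t" "F s < a"
      using cInf_lessD[of "F ` {t<..}" a] by auto
    then have "F x < a" if "t < x" "x < s" for x
      using assms that by (meson le_less_trans less_imp_le monoD)
    then show "eventually (\<lambda>x. F x < a) (at_right t)"
      using s by (auto simp: eventually_at_right_field)
  qed
  then show ?thesis using right_lim_eq by metis
qed

lemma right_lim_mono:
  fixes F :: "real \<Rightarrow> real"
  assumes "mono F"
  shows "mono (right_lim F)"
proof (rule monoI)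
  fix x y :: real assume "x \<le> y"
  have *: "F u \<le> right_lim F u" for u
    by (rule tendsto_lowerbound[OF mono_tendsto_right_lim[OF assms]])
       (use assms in \<open>auto simp: eventually_at_right_field mono_def intro!: exI[of _ "u + 1"]\<close>)
  show "right_lim F x \<le> right_lim F y"
  proof (cases "x = y")
    case False
    with \<open>x \<le> y\<close> have "x < y" by simp
    then have "right_lim F x \<le> F y"
      by (intro tendsto_upperbound[OF mono_tendsto_right_lim[OF assms]])
         (use assms in \<open>auto simp: eventually_at_right_field mono_def\<close>)
    with *[of y] show ?thesis by simp
  qed simp
qed

text \<open>Together with \<open>right_lim_mono\<close> this makes \<open>right_lim F\<close> an
  admissible distribution function for \<open>interval_measure\<close>.\<close>

lemma right_lim_continuous:
  fixes F :: "real \<Rightarrow> real"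
  assumes "mono F"
  shows "continuous (at_right t) (right_lim F)"
  unfolding continuous_within
proof (rule order_tendstoI)
  fix a assume "a < right_lim F t"
  moreover have "right_lim F t \<le> right_lim F x" if "x > t" for x
    using right_lim_mono[OF assms] that by (auto simp: mono_def)
  ultimately have "a < right_lim F x" if "x > t" for x
    using that by (meson less_le_trans)
  then show "eventually (\<lambda>x. a < right_lim F x) (at_right t)"
    by (auto simp: eventually_at_right_field intro!: exI[of _ "t + 1"])
next
  fix a assume "right_lim F t < a"
  then have "eventually (\<lambda>x. F x < a) (at_right t)"
    using order_tendstoD(2)[OF mono_tendsto_right_lim[OF assms]] by blast
  then obtain s where s: "s > t" "\<And>x. t < x \<Longrightarrow> x < s \<Longrightarrow> F x < a"
    by (auto simp: eventually_at_right_field)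
  have "right_lim F x < a" if x: "t < x" "x < s" for x
  proof -
    \<comment> \<open>Monotonicity bounds \<open>right_lim F x\<close> only by values of
      \<open>F\<close> strictly to the right of \<open>x\<close>, so a point between
      \<open>x\<close> and \<open>s\<close> is inserted.\<close>
    obtain y where y: "x < y" "y < s" using dense x by blast
    have "right_lim F x \<le> F y"
      by (intro tendsto_upperbound[OF mono_tendsto_right_lim[OF assms]])
         (use assms y in \<open>auto simp: eventually_at_right_field mono_def\<close>)
    also have "\<dots> < a" using s x y by auto
    finally show ?thesis .
  qed
  then show "eventually (\<lambda>x. right_lim F x < a) (at_right t)"
    using s by (auto simp: eventually_at_right_field)
qed

lemma emeasure_interval_measure_right_lim:
  fixes F :: "real \<Rightarrow> real"
  assumes "mono F" "a \<le> b"
  shows "emeasure (interval_measure (right_lim F)) {a<..b} = ennreal (right_lim F b - right_lim F a)"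
  by (intro emeasure_interval_measure_Ioc right_lim_continuous)
     (use assms right_lim_mono in \<open>auto simp: mono_def\<close>)

lemma sigma_finite_interval_measure_right_lim:
  fixes F :: "real \<Rightarrow> real"
  assumes "mono F"
  shows "sigma_finite_measure (interval_measure (right_lim F))"
  by (intro sigma_finite_interval_measure right_lim_continuous)
     (use assms right_lim_mono in \<open>auto simp: mono_def\<close>)

lemma Ioc_covers: "(\<Union>i::nat. {- real i <.. real i}) = UNIV"
proof -
  have "\<exists>i::nat. - real i < x \<and> x \<le> real i" for x :: real
  proof -
    obtain i :: nat where "\<bar>x\<bar> < real i" using reals_Archimedean2 by blast
    then show ?thesis by (intro exI[of _ i]) linarith
  qed
  then show ?thesis by auto
qed

section \<open>Radon-Nikodym densities of dominated functions\<close>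

text \<open>The measure of \<open>F\<close> is the sum of the measures of \<open>G\<close> and
  \<open>F - G\<close>, so its null sets are null for both summands.\<close>

lemma absolutely_continuous_interval_measure:
  fixes F G :: "real \<Rightarrow> real"
  assumes F: "mono F" and G: "mono G" and FG: "mono (\<lambda>t. F t - G t)"
  shows "absolutely_continuous (interval_measure (right_lim F)) (interval_measure (right_lim G))"
proof -
  let ?H = "\<lambda>t. F t - G t"
  let ?I = "\<lambda>K. interval_measure (right_lim K)"
  \<comment> \<open>\<open>S\<close> is the sum of the two measures; it is shown to be the measure
    of \<open>F\<close>.\<close>
  define S where "S = measure_of UNIV (sets borel) (\<lambda>A. emeasure (?I G) A + emeasure (?I ?H) A)"
  have sum: "right_lim F t = right_lim G t + right_lim ?H t" for t
    by (rule right_lim_eq)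
       (use tendsto_add[OF mono_tendsto_right_lim[OF G, of t] mono_tendsto_right_lim[OF FG, of t]] in simp)
  have S_sets: "sets S = sets borel"
    unfolding S_def by (metis sets.sets_measure_of_eq space_borel)
  have S: "emeasure S A = emeasure (?I G) A + emeasure (?I ?H) A" if "A \<in> sets borel" for A
    unfolding S_def
  proof (rule emeasure_measure_of_sigma)
    show "sigma_algebra UNIV (sets borel :: real set set)"
      by (metis sets.sigma_algebra_axioms space_borel)
    show "countably_additive (sets borel) (\<lambda>A. emeasure (?I G) A + emeasure (?I ?H) A)"
    proof (rule countably_additiveI)
      fix B :: "nat \<Rightarrow> real set"
      assume B: "range B \<subseteq> sets borel" "disjoint_family B"
      have "(\<Sum>i. emeasure (?I K) (B i)) = emeasure (?I K) (\<Union>i. B i)" for K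
        by (rule suminf_emeasure) (use B in auto)
      then show "(\<Sum>i. emeasure (?I G) (B i) + emeasure (?I ?H) (B i))
          = emeasure (?I G) (\<Union>i. B i) + emeasure (?I ?H) (\<Union>i. B i)"
        by (simp add: suminf_add[symmetric])
    qed
  qed (use that in \<open>auto simp: positive_def\<close>)
  have "S = ?I F"
  \<comment> \<open>Half-open intervals are stable under intersection and generate the Borel sets;
    the bounded intervals \<open>{- real i <.. real i}\<close> have finite mass and exhaust the
    line.\<close>
  proof (rule measure_eqI_generator_eq[where E = "range (\<lambda>(a, b). {a<..b::real})" and \<Omega> = UNIV
        and A = "\<lambda>i. {- real i <.. real i}"])
    show "Int_stable (range (\<lambda>(a, b). {a<..b::real}))"
      by (auto simp: Int_stable_def)
    fix X assume "X \<in> range (\<lambda>(a, b). {a<..b::real})"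
    then obtain a b where X: "X = {a<..b}" by auto
    show "emeasure S X = emeasure (?I F) X"
    proof (cases "a \<le> b")
      case True
      have "right_lim G a \<le> right_lim G b" "right_lim ?H a \<le> right_lim ?H b"
        using True right_lim_mono[OF G] right_lim_mono[OF FG] by (auto simp: mono_def)
      then show ?thesis
        by (simp add: X S emeasure_interval_measure_right_lim True F G FG sum
            flip: ennreal_plus)
    qed (simp add: X)
  next
    show "emeasure S {- real i <.. real i} \<noteq> \<infinity>" for i
      by (simp add: S emeasure_interval_measure_right_lim G FG)
  next
    show "sets S = sigma_sets UNIV (range (\<lambda>(a, b). {a<..b::real}))"
      by (simp add: S_sets) (simp add: borel_sigma_sets_Ioc)
    show "sets (?I F) = sigma_sets UNIV (range (\<lambda>(a, b). {a<..b::real}))"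
      by simp (simp add: borel_sigma_sets_Ioc)
  qed (auto simp: Ioc_covers)
  then show ?thesis
    unfolding absolutely_continuous_def
    by (auto simp: null_sets_def) (metis S add_eq_0_iff_both_eq_0)
qed

text \<open>The Radon-Nikodym derivative takes values in \<open>ennreal\<close>; a real density
  comes from truncating it with \<open>enn2real\<close>.\<close>

lemma ex_interval_density_mono:
  fixes F G :: "real \<Rightarrow> real"
  assumes F: "mono F" and G: "mono G" and FG: "mono (\<lambda>t. F t - G t)"
  obtains g :: "real \<Rightarrow> real" where "g \<in> borel_measurable borel"
    "\<And>a b. a \<le> b \<Longrightarrow> set_integrable (interval_measure (right_lim F)) {a<..b} g"
    "\<And>a b. a \<le> b \<Longrightarrow> set_lebesgue_integral (interval_measure (right_lim F)) {a<..b} g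
        = right_lim G b - right_lim G a"
proof -
  let ?\<mu> = "interval_measure (right_lim F)"
  let ?\<nu> = "interval_measure (right_lim G)"
  interpret sigma_finite_measure ?\<mu> by (rule sigma_finite_interval_measure_right_lim[OF F])
  obtain f where f: "f \<in> borel_measurable ?\<mu>" "density ?\<mu> f = ?\<nu>"
    using Radon_Nikodym[OF absolutely_continuous_interval_measure[OF F G FG]] by auto
  note [measurable] = f(1)
  have hb: "has_bochner_integral ?\<mu> (\<lambda>x. indicator {a<..b} x *\<^sub>R enn2real (f x))
      (right_lim G b - right_lim G a)" if ab: "a \<le> b" for a b
  proof (rule has_bochner_integral_nn_integral)
    have nn: "(\<integral>\<^sup>+x. f x * indicator {a<..b} x \<partial>?\<mu>) = ennreal (right_lim G b - right_lim G a)"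
      using emeasure_interval_measure_right_lim[OF G ab] by (simp add: emeasure_density flip: f(2))
    \<comment> \<open>The interval has finite mass, so \<open>f\<close> is finite almost everywhere
      on it and \<open>enn2real\<close> loses nothing there.\<close>
    then have "AE x in ?\<mu>. f x * indicator {a<..b} x \<noteq> \<infinity>"
      by (intro nn_integral_PInf_AE) auto
    then have "(\<integral>\<^sup>+x. ennreal (indicator {a<..b} x *\<^sub>R enn2real (f x)) \<partial>?\<mu>)
        = (\<integral>\<^sup>+x. f x * indicator {a<..b} x \<partial>?\<mu>)"
      by (intro nn_integral_cong_AE) (auto elim!: eventually_mono split: split_indicator simp: less_top)
    with nn show "(\<integral>\<^sup>+x. ennreal (indicator {a<..b} x *\<^sub>R enn2real (f x)) \<partial>?\<mu>)
        = ennreal (right_lim G b - right_lim G a)" by simp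
    show "0 \<le> right_lim G b - right_lim G a"
      using right_lim_mono[OF G] ab by (auto simp: mono_def)
  qed auto
  show ?thesis
  proof (rule that[of "\<lambda>x. enn2real (f x)"])
    show "(\<lambda>x. enn2real (f x)) \<in> borel_measurable borel"
      using f(1) by (simp add: measurable_cong_sets[OF sets_interval_measure refl])
  qed (use hb in \<open>auto simp: set_integrable_def set_lebesgue_integral_def has_bochner_integral_iff\<close>)
qed

text \<open>A Jordan decomposition: domination makes \<open>(F + h) / 2\<close> and
  \<open>(F - h) / 2\<close> monotone. The monotone case gives a density for the first of them, and
  \<open>h\<close> is twice that function minus \<open>F\<close>.\<close>

lemma
  fixes F h :: "real \<Rightarrow> real"
  assumes dom: "\<And>s t. s \<le> t \<Longrightarrow> \<bar>h t - h s\<bar> \<le> F t - F s"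
  shows dominated_tendsto_right_lim: "(h \<longlongrightarrow> right_lim h t) (at_right t)"
    and ex_interval_density: "\<exists>g \<in> borel_measurable borel. \<forall>a b. a \<le> b \<longrightarrow>
      set_integrable (interval_measure (right_lim F)) {a<..b} g \<and>
      set_lebesgue_integral (interval_measure (right_lim F)) {a<..b} g
        = right_lim h b - right_lim h a"
proof -
  let ?P = "\<lambda>t. (F t + h t) / 2" and ?\<mu> = "interval_measure (right_lim F)"
  have F: "mono F" using dom by (intro monoI) (smt (verit))
  have P: "mono ?P" and FP: "mono (\<lambda>t. F t - ?P t)"
    by (intro monoI; drule dom; simp add: field_simps abs_le_iff)+
  have lim: "(h \<longlongrightarrow> 2 * right_lim ?P t - right_lim F t) (at_right t)" for t
    using tendsto_diff[OF tendsto_mult_left[OF mono_tendsto_right_lim[OF P, of t], of 2]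
        mono_tendsto_right_lim[OF F, of t]]
    by (simp add: field_simps)
  then have hlim: "right_lim h t = 2 * right_lim ?P t - right_lim F t" for t
    by (rule right_lim_eq)
  with lim show "(h \<longlongrightarrow> right_lim h t) (at_right t)" by simp
  obtain g where [measurable]: "g \<in> borel_measurable borel"
    and g: "\<And>a b. a \<le> b \<Longrightarrow> set_integrable ?\<mu> {a<..b} g"
      "\<And>a b. a \<le> b \<Longrightarrow> set_lebesgue_integral ?\<mu> {a<..b} g = right_lim ?P b - right_lim ?P a"
    using ex_interval_density_mono[OF F P FP] by blast
  \<comment> \<open>\<open>F\<close> has the constant density 1 with respect to its own
    measure.\<close>
  have one: "set_integrable ?\<mu> {a<..b} (\<lambda>x. 1::real)"
    "set_lebesgue_integral ?\<mu> {a<..b} (\<lambda>x. 1::real) = right_lim F b - right_lim F a"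
    if "a \<le> b" for a b
  proof -
    have m: "emeasure ?\<mu> {a<..b} = ennreal (right_lim F b - right_lim F a)"
      "right_lim F a \<le> right_lim F b"
      using emeasure_interval_measure_right_lim[OF F that] right_lim_mono[OF F] that
      by (auto simp: mono_def)
    then show "set_integrable ?\<mu> {a<..b} (\<lambda>x. 1::real)"
      by (simp add: set_integrable_def)
    show "set_lebesgue_integral ?\<mu> {a<..b} (\<lambda>x. 1::real) = right_lim F b - right_lim F a"
      using m by (simp add: set_lebesgue_integral_def measure_def)
  qed
  show "\<exists>g \<in> borel_measurable borel. \<forall>a b. a \<le> b \<longrightarrow>
      set_integrable ?\<mu> {a<..b} g \<and>
      set_lebesgue_integral ?\<mu> {a<..b} g = right_lim h b - right_lim h a"
  \<comment> \<open>This mirrors \<open>h = 2 * ?P - F\<close>, with \<open>g\<close> a density for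
    \<open>?P\<close> and 1 for \<open>F\<close>.\<close>
  proof (rule bexI[of _ "\<lambda>x. 2 * g x - 1"], intro allI impI conjI)
    fix a b :: real assume ab: "a \<le> b"
    have i: "set_integrable ?\<mu> {a<..b} (\<lambda>x. 2 * g x)" using g(1)[OF ab] by simp
    show "set_integrable ?\<mu> {a<..b} (\<lambda>x. 2 * g x - 1)"
      by (rule set_integral_diff(1)[OF i one(1)[OF ab]])
    show "set_lebesgue_integral ?\<mu> {a<..b} (\<lambda>x. 2 * g x - 1) = right_lim h b - right_lim h a"
      by (simp add: set_integral_diff(2)[OF i one(1)[OF ab]] g(2)[OF ab] one(2)[OF ab] hlim)
  qed simp
qed

section \<open>Sign of a density\<close>

text \<open>As the sign of \<open>g\<close> is unknown, its integrals form at first only a signed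
  set function. They agree with the measure of \<open>G\<close> on intervals, hence on all Borel
  subsets of a bounded interval, and so are nonnegative.\<close>

lemma AE_nonneg_interval_density:
  fixes F G g :: "real \<Rightarrow> real"
  assumes F: "mono F" and G: "mono G" and g [measurable]: "g \<in> borel_measurable borel"
    and int: "\<And>a b. a \<le> b \<Longrightarrow> set_integrable (interval_measure (right_lim F)) {a<..b} g"
      "\<And>a b. a \<le> b \<Longrightarrow> set_lebesgue_integral (interval_measure (right_lim F)) {a<..b} g
        = right_lim G b - right_lim G a"
  shows "AE t in interval_measure (right_lim F). 0 \<le> g t"
proof -
  let ?\<mu> = "interval_measure (right_lim F)"
  let ?\<nu> = "interval_measure (right_lim G)"
  interpret sigma_finite_measure ?\<mu> by (rule sigma_finite_interval_measure_right_lim[OF F])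
  have Ioc: "set_lebesgue_integral ?\<mu> {a<..b} g = measure ?\<nu> {a<..b}" for a b
  proof (cases "a \<le> b")
    case True
    moreover have "right_lim G a \<le> right_lim G b"
      using right_lim_mono[OF G] True by (auto simp: mono_def)
    ultimately show ?thesis
      using emeasure_interval_measure_right_lim[OF G True] int(2)[OF True] by (simp add: measure_def)
  qed (simp add: set_lebesgue_integral_def)
  \<comment> \<open>Restriction to a bounded interval makes \<open>g\<close> integrable and the
    measure of \<open>G\<close> finite, as subtraction for complements requires.\<close>
  have "AE t in ?\<mu>. t \<in> {- real N<..real N} \<longrightarrow> 0 \<le> g t" for N :: nat
  proof -
    let ?I = "{- real N<..real N}"
    have fin: "emeasure ?\<nu> ?I \<noteq> \<infinity>"
      by (simp add: emeasure_interval_measure_right_lim G)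
    have intI: "set_integrable ?\<mu> ?I g" by (rule int(1)) simp
    have sub: "set_integrable ?\<mu> (A \<inter> ?I) g" if "A \<in> sets borel" for A
      by (rule set_integrable_subset[OF intI]) (use that in auto)
    \<comment> \<open>Dynkin's argument: both sides are additive under complements in
      \<open>?I\<close> and countably additive over disjoint unions.\<close>
    have main: "set_lebesgue_integral ?\<mu> (A \<inter> ?I) g = measure ?\<nu> (A \<inter> ?I)"
      if "A \<in> sigma_sets UNIV (range (\<lambda>(a, b). {a<..b::real}))" for A
    proof (rule sigma_sets_induct_disjoint[OF _ _ that])
      show "Int_stable (range (\<lambda>(a, b). {a<..b::real}))"
        by (auto simp: Int_stable_def)
      show "set_lebesgue_integral ?\<mu> (A \<inter> ?I) g = measure ?\<nu> (A \<inter> ?I)"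
        if "A \<in> range (\<lambda>(a, b). {a<..b::real})" for A
        using that Ioc by auto
      have borel: "sigma_sets UNIV (range (\<lambda>(a, b). {a<..b::real})) = sets borel"
        by (simp add: borel_sigma_sets_Ioc)
      show "set_lebesgue_integral ?\<mu> ((UNIV - A) \<inter> ?I) g = measure ?\<nu> ((UNIV - A) \<inter> ?I)"
        if A: "A \<in> sigma_sets UNIV (range (\<lambda>(a, b). {a<..b::real}))"
          and IH: "set_lebesgue_integral ?\<mu> (A \<inter> ?I) g = measure ?\<nu> (A \<inter> ?I)" for A
      proof -
        have [measurable]: "A \<in> sets borel" using A borel by auto
        have eq: "(UNIV - A) \<inter> ?I = ?I - A \<inter> ?I" by auto
        have "?I = (?I - A \<inter> ?I) \<union> (A \<inter> ?I)" by auto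
        then have "set_lebesgue_integral ?\<mu> ?I g
            = set_lebesgue_integral ?\<mu> (?I - A \<inter> ?I) g + set_lebesgue_integral ?\<mu> (A \<inter> ?I) g"
          using set_integral_Un[of "?I - A \<inter> ?I" "A \<inter> ?I" ?\<mu> g] sub[of A] sub[of "UNIV - A"] eq
          by auto
        moreover have "measure ?\<nu> (?I - A \<inter> ?I) = measure ?\<nu> ?I - measure ?\<nu> (A \<inter> ?I)"
          by (rule measure_Diff) (use fin in auto)
        ultimately show ?thesis using IH Ioc eq by simp
      qed
      show "set_lebesgue_integral ?\<mu> ((\<Union>i::nat. A i) \<inter> ?I) g = measure ?\<nu> ((\<Union>i. A i) \<inter> ?I)"
        if dis: "disjoint_family A"
          and A: "range A \<subseteq> sigma_sets UNIV (range (\<lambda>(a, b). {a<..b::real}))"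
          and IH: "\<And>i. set_lebesgue_integral ?\<mu> (A i \<inter> ?I) g = measure ?\<nu> (A i \<inter> ?I)" for A
      proof -
        have m [measurable]: "A i \<in> sets borel" for i using A borel by auto
        have eq: "(\<Union>i. A i) \<inter> ?I = (\<Union>i. A i \<inter> ?I)" by auto
        have "set_lebesgue_integral ?\<mu> (\<Union>i. A i \<inter> ?I) g
            = (\<Sum>i. set_lebesgue_integral ?\<mu> (A i \<inter> ?I) g)"
        proof (rule lebesgue_integral_countable_add)
          show "set_integrable ?\<mu> (\<Union>i. A i \<inter> ?I) g"
            unfolding eq[symmetric] by (rule sub) measurable
        qed (use dis in \<open>auto simp: disjoint_family_on_def\<close>)
        moreover have "(\<lambda>i. measure ?\<nu> (A i \<inter> ?I)) sums measure ?\<nu> (\<Union>i. A i \<inter> ?I)"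
        proof (rule measure_UNION)
          show "range (\<lambda>i. A i \<inter> ?I) \<subseteq> sets ?\<nu>" using m by auto
          show "disjoint_family (\<lambda>i. A i \<inter> ?I)" using dis by (auto simp: disjoint_family_on_def)
          have "emeasure ?\<nu> (\<Union>i. A i \<inter> ?I) \<le> emeasure ?\<nu> ?I"
            by (rule emeasure_mono) auto
          with fin show "emeasure ?\<nu> (\<Union>i. A i \<inter> ?I) \<noteq> \<infinity>"
            by (metis infinity_ennreal_def neq_top_trans)
        qed
        ultimately show ?thesis unfolding eq using IH by (simp add: sums_iff)
      qed
    qed (auto simp: set_lebesgue_integral_def)
    \<comment> \<open>An integrable function with nonnegative integral over every measurable set is
      nonnegative almost everywhere.\<close>
    have "AE t in ?\<mu>. 0 \<le> indicator ?I t *\<^sub>R g t"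
    proof (rule density_nonneg)
      show "integrable ?\<mu> (\<lambda>t. indicator ?I t *\<^sub>R g t)"
        using intI by (simp add: set_integrable_def)
      fix A assume "A \<in> sets ?\<mu>"
      then have "A \<in> sigma_sets UNIV (range (\<lambda>(a, b). {a<..b::real}))"
        by simp (simp add: borel_sigma_sets_Ioc)
      from main[OF this] have "set_lebesgue_integral ?\<mu> (A \<inter> ?I) g \<ge> 0" by simp
      then show "set_lebesgue_integral ?\<mu> A (\<lambda>t. indicator ?I t *\<^sub>R g t) \<ge> 0"
        by (simp add: set_lebesgue_integral_def indicator_inter_arith mult.assoc)
    qed
    then show ?thesis by (auto elim!: eventually_mono split: split_indicator_asm)
  qed
  then have "AE t in ?\<mu>. \<forall>N::nat. t \<in> {- real N<..real N} \<longrightarrow> 0 \<le> g t"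
    unfolding AE_all_countable by blast
  then show ?thesis
    by (rule eventually_mono) (use Ioc_covers in blast)
qed

section \<open>Positive semidefinite matrices\<close>

text \<open>Arguments are plain functions, of which only the values below \<open>n\<close> enter;
  linearity rules then need no carrier conditions. The form is antilinear in \<open>u\<close>, in
  accordance with \<open>L2_inner\<close>.\<close>

definition hform :: "nat \<Rightarrow> complex mat \<Rightarrow> (nat \<Rightarrow> complex) \<Rightarrow> (nat \<Rightarrow> complex) \<Rightarrow> complex" where
  "hform n B u v = (\<Sum>i<n. \<Sum>j<n. cnj (u i) * v j * B $$ (i, j))"

lemma hform_eq_cscalar_prod:
  assumes "B \<in> carrier_mat n n" "u \<in> carrier_vec n" "v \<in> carrier_vec n"
  shows "(B *\<^sub>v v) \<bullet>c u = hform n B (($) u) (($) v)"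
  using assms
  by (auto simp: scalar_prod_def hform_def sum_distrib_left sum_distrib_right row_def
      lessThan_atLeast0 intro!: sum.cong)

lemma hform_cong:
  "(\<And>i. i < n \<Longrightarrow> u i = u' i) \<Longrightarrow> (\<And>i. i < n \<Longrightarrow> v i = v' i) \<Longrightarrow> hform n B u v = hform n B u' v'"
  by (simp add: hform_def)

lemma hform_add_left: "hform n B (\<lambda>i. u i + u' i) v = hform n B u v + hform n B u' v"
  by (simp add: hform_def algebra_simps sum.distrib)

lemma hform_add_right: "hform n B u (\<lambda>i. v i + v' i) = hform n B u v + hform n B u v'"
  by (simp add: hform_def algebra_simps sum.distrib)

lemma hform_scale_left: "hform n B (\<lambda>i. c * u i) v = cnj c * hform n B u v"
  by (simp add: hform_def algebra_simps sum_distrib_left)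

lemma hform_scale_right: "hform n B u (\<lambda>i. c * v i) = c * hform n B u v"
  by (simp add: hform_def algebra_simps sum_distrib_left)

lemma hform_sum_left: "hform n B (\<lambda>i. \<Sum>k\<in>K. u k i) v = (\<Sum>k\<in>K. hform n B (u k) v)"
  unfolding hform_def
  by (simp add: sum_distrib_left sum_distrib_right sum.swap[of _ K])

lemma hform_sum_right: "hform n B u (\<lambda>i. \<Sum>k\<in>K. v k i) = (\<Sum>k\<in>K. hform n B u (v k))"
  unfolding hform_def
  by (simp add: sum_distrib_left sum_distrib_right sum.swap[of _ K])

lemma hform_single:
  assumes "i < n" "j < n"
  shows "hform n B (\<lambda>k. if k = i then a else 0) (\<lambda>k. if k = j then b else 0) = cnj a * b * B $$ (i, j)"
proof -
  have "cnj (if k = i then a else 0) * (if l = j then b else 0) * B $$ (k, l)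
      = (if k = i then if l = j then cnj a * b * B $$ (i, j) else 0 else 0)" for k l by auto
  then have "hform n B (\<lambda>k. if k = i then a else 0) (\<lambda>k. if k = j then b else 0)
      = (\<Sum>k<n. if k = i then \<Sum>l<n. if l = j then cnj a * b * B $$ (i, j) else 0 else 0)"
    unfolding hform_def by (intro sum.cong refl) auto
  then show ?thesis using assms by simp
qed

lemma hermitian_entries:
  assumes "B \<in> carrier_mat n n" "mat_adjoint B = B" "i < n" "j < n"
  shows "B $$ (j, i) = cnj (B $$ (i, j))"
proof -
  have "mat_adjoint B $$ (j, i) = cnj (B $$ (i, j))"
    using assms(1,3,4) unfolding mat_adjoint_def
    by (auto simp: mat_of_rows_def conjugate_complex_def)
  then show ?thesis by (simp add: assms(2))
qed

lemma Im_hform_hermitian: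
  assumes "B \<in> carrier_mat n n" "mat_adjoint B = B"
  shows "Im (hform n B v v) = 0"
proof -
  have "cnj (hform n B v v) = (\<Sum>i<n. \<Sum>j<n. cnj (v j) * v i * B $$ (j, i))"
    unfolding hform_def
    by (auto simp: hermitian_entries[OF assms, symmetric] ac_simps intro!: sum.cong)
  also have "\<dots> = hform n B v v"
    unfolding hform_def by (rule sum.swap)
  finally show ?thesis by (simp add: complex_eq_iff)
qed

lemma Re_hform_psd:
  assumes "psd_mat n B"
  shows "0 \<le> Re (hform n B v v)"
proof -
  have "0 \<le> Re ((B *\<^sub>v Matrix.vec n v) \<bullet>c Matrix.vec n v)"
    using assms by (auto simp: psd_mat_def)
  also have "(B *\<^sub>v Matrix.vec n v) \<bullet>c Matrix.vec n v = hform n B (($) (Matrix.vec n v)) (($) (Matrix.vec n v))"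
    using assms by (intro hform_eq_cscalar_prod) (auto simp: psd_mat_def)
  also have "\<dots> = hform n B v v" by (rule hform_cong) auto
  finally show ?thesis .
qed

text \<open>For \<open>cmod c = 1\<close>, positivity on the sum of the \<open>i\<close>-th basis
  vector and \<open>c\<close> times the \<open>j\<close>-th gives a lower bound for
  \<open>Re (c * B $$ (i, j))\<close> by minus the mean of two diagonal entries. Replacing
  \<open>c\<close> by \<open>- c\<close> gives the upper bound, and each diagonal entry is at most
  the trace.\<close>

lemma psd_entry_le_trace:
  assumes B: "psd_mat n B" and ij: "i < n" "j < n"
  shows "\<bar>Re (B $$ (i, j))\<bar> \<le> (\<Sum>k<n. Re (B $$ (k, k)))"
    and "\<bar>Im (B $$ (i, j))\<bar> \<le> (\<Sum>k<n. Re (B $$ (k, k)))"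
proof -
  have B': "B \<in> carrier_mat n n" "mat_adjoint B = B" using B by (auto simp: psd_mat_def)
  have diag_nonneg: "0 \<le> Re (B $$ (k, k))" if "k < n" for k
    using Re_hform_psd[OF B, of "\<lambda>l. if l = k then 1 else 0"] hform_single[OF that that, of B 1 1]
    by simp
  have two: "\<bar>Re (c * B $$ (i, j))\<bar> \<le> (\<Sum>k<n. Re (B $$ (k, k)))" if c: "cmod c = 1" for c
  proof -
    define S where "S = (\<Sum>k<n. Re (B $$ (k, k)))"
    have diag_le: "Re (B $$ (k, k)) \<le> S" if "k < n" for k
      unfolding S_def by (rule member_le_sum) (use diag_nonneg that in auto)
    have aux: "0 \<le> Re (B $$ (i, i)) + Re (B $$ (j, j)) + 2 * Re (c * B $$ (i, j))"
      if c: "cmod c = 1" for c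
    proof -
      have "cnj c * c = 1"
        using complex_norm_square[of c] c by (simp add: mult.commute)
      moreover have "Re (cnj c * cnj z) = Re (c * z)" for z by simp
      ultimately show ?thesis
        using Re_hform_psd[OF B, of "\<lambda>k. (if k = i then 1 else 0) + (if k = j then c else 0)"]
        by (simp add: hform_add_left hform_add_right hform_single ij
            hermitian_entries[OF B' ij] del: complex_cnj_mult mult.right_neutral)
    qed
    have "\<bar>Re (c * B $$ (i, j))\<bar> \<le> (Re (B $$ (i, i)) + Re (B $$ (j, j))) / 2"
      using aux[OF c] aux[of "- c"] c unfolding abs_le_iff by (auto simp: field_simps)
    also have "\<dots> \<le> S" using diag_le[OF ij(1)] diag_le[OF ij(2)] by simp
    finally show ?thesis by (simp add: S_def)
  qed
  show "\<bar>Re (B $$ (i, j))\<bar> \<le> (\<Sum>k<n. Re (B $$ (k, k)))" using two[of 1] by simp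
  \<comment> \<open>Multiplication by \<open>\<i>\<close> turns the imaginary part into a real part,
    up to sign.\<close>
  show "\<bar>Im (B $$ (i, j))\<bar> \<le> (\<Sum>k<n. Re (B $$ (k, k)))" using two[of \<i>] by simp
qed

text \<open>A Cauchy-Schwarz argument: since the form vanishes at \<open>u\<close>, its value at
  \<open>c * u + w\<close> is real-affine in \<open>c\<close>, and nonnegativity for all
  \<open>c\<close> kills the part depending on \<open>c\<close>.\<close>

lemma psd_form_null:
  assumes Re: "\<And>v. 0 \<le> Re (hform n B v v)" and Im: "\<And>v. Im (hform n B v v) = 0"
    and u: "hform n B u u = 0"
  shows "hform n B u w = 0" "hform n B w u = 0"
proof -
  let ?z = "hform n B u w" and ?z' = "hform n B w u"
  have expand: "hform n B (\<lambda>i. c * u i + w i) (\<lambda>i. c * u i + w i)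
      = cnj c * ?z + c * ?z' + hform n B w w" for c
    by (simp add: hform_add_left hform_add_right hform_scale_left hform_scale_right u)
  have "Im (cnj c * ?z + c * ?z') = 0" for c
    using Im[of "\<lambda>i. c * u i + w i"] Im[of w] unfolding expand by simp
  \<comment> \<open>Reality at \<open>c = 1\<close> matches the imaginary parts, at
    \<open>c = \<i>\<close> the real parts.\<close>
  from this[of 1] this[of \<i>] have cnj: "?z' = cnj ?z" by (simp add: complex_eq_iff)
  have "?z = 0"
  proof (rule ccontr)
    assume "?z \<noteq> 0"
    \<comment> \<open>With this \<open>s\<close>, the value at
      \<open>- of_real s * ?z * u + w\<close> has real part exactly -1.\<close>
    define s where "s = (Re (hform n B w w) + 1) / (2 * (cmod ?z)\<^sup>2)"
    have "0 \<le> Re (cnj (- of_real s * ?z) * ?z + (- of_real s * ?z) * cnj ?z + hform n B w w)"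
      using Re[of "\<lambda>i. (- of_real s * ?z) * u i + w i"] unfolding expand cnj .
    also have "\<dots> = Re (hform n B w w) - 2 * s * (cmod ?z)\<^sup>2"
      by (simp add: cmod_power2 algebra_simps flip: power2_eq_square)
    also have "\<dots> < 0" using \<open>?z \<noteq> 0\<close> by (simp add: s_def)
    finally show False by simp
  qed
  then show "?z = 0" "?z' = 0" using cnj by simp_all
qed

section \<open>Approximation by scaled Gaussian integer vectors\<close>

lemma floor_scaled_tendsto: "(\<lambda>k. of_int \<lfloor>real (Suc k) * x\<rfloor> / real (Suc k)) \<longlonglongrightarrow> x"
proof (rule tendsto_sandwich)
  have "x - inverse (real (Suc k)) \<le> of_int \<lfloor>real (Suc k) * x\<rfloor> / real (Suc k)"
    "of_int \<lfloor>real (Suc k) * x\<rfloor> / real (Suc k) \<le> x" for k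
  proof -
    have "(real (Suc k) * x - 1) / real (Suc k) \<le> of_int \<lfloor>real (Suc k) * x\<rfloor> / real (Suc k)"
      "of_int \<lfloor>real (Suc k) * x\<rfloor> / real (Suc k) \<le> (real (Suc k) * x) / real (Suc k)"
      by (intro divide_right_mono; linarith)+
    then show "x - inverse (real (Suc k)) \<le> of_int \<lfloor>real (Suc k) * x\<rfloor> / real (Suc k)"
      "of_int \<lfloor>real (Suc k) * x\<rfloor> / real (Suc k) \<le> x"
      by (simp_all add: diff_divide_distrib inverse_eq_divide del: of_nat_Suc)
  qed
  then show "\<forall>\<^sub>F k in sequentially. x - inverse (real (Suc k)) \<le> of_int \<lfloor>real (Suc k) * x\<rfloor> / real (Suc k)"
    "\<forall>\<^sub>F k in sequentially. of_int \<lfloor>real (Suc k) * x\<rfloor> / real (Suc k) \<le> x" by auto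
  show "(\<lambda>k. x - inverse (real (Suc k))) \<longlonglongrightarrow> x"
    using tendsto_diff[OF tendsto_const LIMSEQ_inverse_real_of_nat, of x] by simp
qed simp

text \<open>The vectors \<open>u k / Suc k\<close> converge to \<open>v\<close>; the form is
  continuous, and the scaling factor leaves it squared. Using \<open>Suc k\<close> avoids division
  by zero.\<close>

lemma hform_limit_gaussian:
  fixes v :: "nat \<Rightarrow> complex"
  defines "u \<equiv> \<lambda>k i. Complex (of_int \<lfloor>real (Suc k) * Re (v i)\<rfloor>) (of_int \<lfloor>real (Suc k) * Im (v i)\<rfloor>)"
  shows "(\<lambda>k. hform n B (u k) (u k) / of_real ((real (Suc k))\<^sup>2)) \<longlonglongrightarrow> hform n B v v"
proof -
  have u: "(\<lambda>k. of_real (1 / real (Suc k)) * u k i) \<longlonglongrightarrow> v i" for i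
  proof -
    have "of_real (1 / real (Suc k)) * u k i = Complex (of_int \<lfloor>real (Suc k) * Re (v i)\<rfloor> / real (Suc k))
        (of_int \<lfloor>real (Suc k) * Im (v i)\<rfloor> / real (Suc k))" for k
      by (simp add: u_def complex_eq_iff del: of_nat_Suc)
    then show ?thesis
      using tendsto_Complex[OF floor_scaled_tendsto floor_scaled_tendsto, of "Re (v i)" "Im (v i)"]
      by simp
  qed
  have "(\<lambda>k. hform n B (\<lambda>i. of_real (1 / real (Suc k)) * u k i) (\<lambda>i. of_real (1 / real (Suc k)) * u k i))
      \<longlonglongrightarrow> hform n B v v"
    unfolding hform_def by (intro tendsto_sum tendsto_mult tendsto_cnj u tendsto_const)
  also have "(\<lambda>k. hform n B (\<lambda>i. of_real (1 / real (Suc k)) * u k i) (\<lambda>i. of_real (1 / real (Suc k)) * u k i))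
      = (\<lambda>k. hform n B (u k) (u k) / of_real ((real (Suc k))\<^sup>2))"
    unfolding hform_scale_left hform_scale_right
    by (simp add: power2_eq_square del: of_nat_Suc)
  finally show ?thesis .
qed

section \<open>The density of the matrix measure\<close>

abbreviation entry_right_lim :: "(real \<Rightarrow> complex mat) \<Rightarrow> nat \<Rightarrow> nat \<Rightarrow> real \<Rightarrow> complex" where
  "entry_right_lim \<sigma> i j \<equiv> right_lim (\<lambda>t. \<sigma> t $$ (i, j))"

section \<open>Entrywise densities of a nondecreasing matrix function\<close>

text \<open>The trace bound for the positive semidefinite increment
  \<open>\<sigma> t - \<sigma> s\<close>; it supplies the domination hypothesis of
  \<open>ex_interval_density\<close>.\<close>

lemma
  assumes \<sigma>: "nondecreasing_mat_fun n \<sigma>" and ij: "i < n" "j < n" and st: "s \<le> t"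
  shows Re_entry_dominated:
      "\<bar>Re (\<sigma> t $$ (i, j)) - Re (\<sigma> s $$ (i, j))\<bar> \<le> (\<Sum>i<n. Re (\<sigma> t $$ (i, i))) - (\<Sum>i<n. Re (\<sigma> s $$ (i, i)))"
    and Im_entry_dominated:
      "\<bar>Im (\<sigma> t $$ (i, j)) - Im (\<sigma> s $$ (i, j))\<bar> \<le> (\<Sum>i<n. Re (\<sigma> t $$ (i, i))) - (\<Sum>i<n. Re (\<sigma> s $$ (i, i)))"
proof -
  have psd: "psd_mat n (\<sigma> t - \<sigma> s)" and car: "\<sigma> t \<in> carrier_mat n n" "\<sigma> s \<in> carrier_mat n n"
    using \<sigma> st by (auto simp: nondecreasing_mat_fun_def)
  have "(\<sigma> t - \<sigma> s) $$ (k, l) = \<sigma> t $$ (k, l) - \<sigma> s $$ (k, l)" if "k < n" "l < n" for k l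
    using that car by auto
  then show "\<bar>Re (\<sigma> t $$ (i, j)) - Re (\<sigma> s $$ (i, j))\<bar> \<le> (\<Sum>i<n. Re (\<sigma> t $$ (i, i))) - (\<Sum>i<n. Re (\<sigma> s $$ (i, i)))"
    "\<bar>Im (\<sigma> t $$ (i, j)) - Im (\<sigma> s $$ (i, j))\<bar> \<le> (\<Sum>i<n. Re (\<sigma> t $$ (i, i))) - (\<Sum>i<n. Re (\<sigma> s $$ (i, i)))"
    using psd_entry_le_trace[OF psd ij] ij by (simp_all add: sum_subtractf)
qed

lemma trace_mono: "nondecreasing_mat_fun n \<sigma> \<Longrightarrow> mono (\<lambda>t. \<Sum>i<n. Re (\<sigma> t $$ (i, i)))"
proof (cases "n = 0")
  case False
  assume "nondecreasing_mat_fun n \<sigma>"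
  \<comment> \<open>The increment of the trace dominates an absolute value and is therefore
    nonnegative.\<close>
  with Re_entry_dominated[of n \<sigma> 0 0] False show ?thesis
    by (intro monoI) (smt (verit) gr0I)
qed (simp add: mono_def)

lemma entry_tendsto:
  assumes \<sigma>: "nondecreasing_mat_fun n \<sigma>" and ij: "i < n" "j < n"
  shows "((\<lambda>s. \<sigma> s $$ (i, j)) \<longlongrightarrow> entry_right_lim \<sigma> i j t) (at_right t)"
    and "entry_right_lim \<sigma> i j t
      = Complex (right_lim (\<lambda>s. Re (\<sigma> s $$ (i, j))) t) (right_lim (\<lambda>s. Im (\<sigma> s $$ (i, j))) t)"
proof -
  have lim: "((\<lambda>s. Complex (Re (\<sigma> s $$ (i, j))) (Im (\<sigma> s $$ (i, j)))) \<longlongrightarrow>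
      Complex (right_lim (\<lambda>s. Re (\<sigma> s $$ (i, j))) t) (right_lim (\<lambda>s. Im (\<sigma> s $$ (i, j))) t)) (at_right t)"
    by (intro tendsto_Complex dominated_tendsto_right_lim[OF Re_entry_dominated[OF \<sigma> ij]]
        dominated_tendsto_right_lim[OF Im_entry_dominated[OF \<sigma> ij]])
  then show eq: "entry_right_lim \<sigma> i j t
      = Complex (right_lim (\<lambda>s. Re (\<sigma> s $$ (i, j))) t) (right_lim (\<lambda>s. Im (\<sigma> s $$ (i, j))) t)"
    by (intro right_lim_eq) simp
  show "((\<lambda>s. \<sigma> s $$ (i, j)) \<longlongrightarrow> entry_right_lim \<sigma> i j t) (at_right t)"
    using lim unfolding eq by simp
qed

text \<open>Real and imaginary parts of each entry receive their densities separately. Positivity of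
  the resulting matrix is established afterwards.\<close>

lemma ex_density_mat:
  assumes \<sigma>: "nondecreasing_mat_fun n \<sigma>"
  shows "\<exists>M. is_density_mat n \<sigma> M"
proof -
  let ?\<mu> = "trace_measure n \<sigma>"
  have "\<exists>g. g \<in> borel_measurable borel \<and> (\<forall>a b. a \<le> b \<longrightarrow> set_integrable ?\<mu> {a<..b} g \<and>
        set_lebesgue_integral ?\<mu> {a<..b} g = entry_right_lim \<sigma> i j b - entry_right_lim \<sigma> i j a)"
    if ij: "i < n" "j < n" for i j
  proof -
    from ex_interval_density[OF Re_entry_dominated[OF \<sigma> ij], folded trace_measure_def]
    obtain g1 where [measurable]: "g1 \<in> borel_measurable borel"
      and g1: "\<forall>a b. a \<le> b \<longrightarrow> set_integrable ?\<mu> {a<..b} g1 \<and>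
        set_lebesgue_integral ?\<mu> {a<..b} g1
          = right_lim (\<lambda>t. Re (\<sigma> t $$ (i, j))) b - right_lim (\<lambda>t. Re (\<sigma> t $$ (i, j))) a"
      by (rule bexE)
    from ex_interval_density[OF Im_entry_dominated[OF \<sigma> ij], folded trace_measure_def]
    obtain g2 where [measurable]: "g2 \<in> borel_measurable borel"
      and g2: "\<forall>a b. a \<le> b \<longrightarrow> set_integrable ?\<mu> {a<..b} g2 \<and>
        set_lebesgue_integral ?\<mu> {a<..b} g2
          = right_lim (\<lambda>t. Im (\<sigma> t $$ (i, j))) b - right_lim (\<lambda>t. Im (\<sigma> t $$ (i, j))) a"
      by (rule bexE)
    let ?g = "\<lambda>t. complex_of_real (g1 t) + \<i> * complex_of_real (g2 t)"
    have "has_bochner_integral ?\<mu> (\<lambda>t. indicator {a<..b} t *\<^sub>R ?g t)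
        (entry_right_lim \<sigma> i j b - entry_right_lim \<sigma> i j a)" if ab: "a \<le> b" for a b
    proof -
      have "has_bochner_integral ?\<mu> (\<lambda>t. indicator {a<..b} t *\<^sub>R g1 t)
          (right_lim (\<lambda>t. Re (\<sigma> t $$ (i, j))) b - right_lim (\<lambda>t. Re (\<sigma> t $$ (i, j))) a)"
        "has_bochner_integral ?\<mu> (\<lambda>t. indicator {a<..b} t *\<^sub>R g2 t)
          (right_lim (\<lambda>t. Im (\<sigma> t $$ (i, j))) b - right_lim (\<lambda>t. Im (\<sigma> t $$ (i, j))) a)"
        using g1[rule_format, OF ab] g2[rule_format, OF ab]
        by (auto simp: has_bochner_integral_iff set_integrable_def set_lebesgue_integral_def)
      from has_bochner_integral_add[OF has_bochner_integral_of_real[OF this(1)]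
          has_bochner_integral_mult_right[OF has_bochner_integral_of_real[OF this(2)], of \<i>]]
      show ?thesis
        unfolding entry_tendsto(2)[OF \<sigma> ij]
        by (elim has_bochner_integral_cong[THEN iffD1, rotated 3])
           (auto simp: complex_eq_iff split: split_indicator)
    qed
    then show ?thesis
      by (intro exI[of _ ?g])
         (auto simp: has_bochner_integral_iff set_integrable_def set_lebesgue_integral_def)
  qed
  then obtain g where g: "\<And>i j. i < n \<Longrightarrow> j < n \<Longrightarrow> g i j \<in> borel_measurable borel \<and>
      (\<forall>a b. a \<le> b \<longrightarrow> set_integrable ?\<mu> {a<..b} (g i j) \<and>
        set_lebesgue_integral ?\<mu> {a<..b} (g i j) = entry_right_lim \<sigma> i j b - entry_right_lim \<sigma> i j a)"
    by metis
  have "is_density_mat n \<sigma> (\<lambda>t. Matrix.mat n n (\<lambda>(i, j). g i j t))"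
    using g by (simp add: is_density_mat_def)
  then show ?thesis by blast
qed

text \<open>Existence turns the choice made by \<open>SOME\<close> into a genuine density.\<close>

lemma is_density_density_mat:
  "nondecreasing_mat_fun n \<sigma> \<Longrightarrow> is_density_mat n \<sigma> (density_mat n \<sigma>)"
  unfolding density_mat_def by (rule someI_ex[of "is_density_mat n \<sigma>"]) (rule ex_density_mat)

lemma density_mat_carrier:
  "nondecreasing_mat_fun n \<sigma> \<Longrightarrow> density_mat n \<sigma> t \<in> carrier_mat n n"
  using is_density_density_mat by (auto simp: is_density_mat_def)

lemma density_mat_measurable:
  "nondecreasing_mat_fun n \<sigma> \<Longrightarrow> i < n \<Longrightarrow> j < n \<Longrightarrow>
    (\<lambda>t. density_mat n \<sigma> t $$ (i, j)) \<in> borel_measurable borel"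
  using is_density_density_mat by (auto simp: is_density_mat_def)

lemma hform_density_integral:
  assumes \<sigma>: "nondecreasing_mat_fun n \<sigma>" and ab: "a \<le> b"
  shows "has_bochner_integral (trace_measure n \<sigma>)
    (\<lambda>t. indicator {a<..b} t *\<^sub>R hform n (density_mat n \<sigma> t) v v)
    ((\<Sum>i<n. \<Sum>j<n. cnj (v i) * v j * entry_right_lim \<sigma> i j b)
      - (\<Sum>i<n. \<Sum>j<n. cnj (v i) * v j * entry_right_lim \<sigma> i j a))"
proof -
  have "has_bochner_integral (trace_measure n \<sigma>)
      (\<lambda>t. indicator {a<..b} t *\<^sub>R density_mat n \<sigma> t $$ (i, j))
      (entry_right_lim \<sigma> i j b - entry_right_lim \<sigma> i j a)" if "i < n" "j < n" for i j
    using is_density_density_mat[OF \<sigma>] that ab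
    by (auto simp: is_density_mat_def has_bochner_integral_iff set_integrable_def
        set_lebesgue_integral_def)
  then have "has_bochner_integral (trace_measure n \<sigma>)
      (\<lambda>t. \<Sum>i<n. \<Sum>j<n. (cnj (v i) * v j) * (indicator {a<..b} t *\<^sub>R density_mat n \<sigma> t $$ (i, j)))
      (\<Sum>i<n. \<Sum>j<n. (cnj (v i) * v j) * (entry_right_lim \<sigma> i j b - entry_right_lim \<sigma> i j a))"
    by (intro has_bochner_integral_sum has_bochner_integral_mult_right) auto
  then show ?thesis
    by (simp add: hform_def scaleR_sum_right right_diff_distrib sum_subtractf)
qed

lemma hform_density_measurable:
  assumes \<sigma>: "nondecreasing_mat_fun n \<sigma>"
  shows "(\<lambda>t. hform n (density_mat n \<sigma> t) v v) \<in> borel_measurable borel"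
  unfolding hform_def
  by (intro borel_measurable_sum borel_measurable_times borel_measurable_const
      density_mat_measurable[OF \<sigma>]) auto

section \<open>Almost everywhere positivity of the density matrix\<close>

text \<open>For fixed \<open>v\<close> the form of the density is the density of the form of
  \<open>\<sigma>\<close>, which is real and nondecreasing in \<open>t\<close>. The exceptional null
  set may still depend on \<open>v\<close>.\<close>

lemma AE_hform_density_vector:
  assumes \<sigma>: "nondecreasing_mat_fun n \<sigma>"
  shows "AE t in trace_measure n \<sigma>. 0 \<le> Re (hform n (density_mat n \<sigma> t) v v)
    \<and> Im (hform n (density_mat n \<sigma> t) v v) = 0"
proof -
  let ?S = "\<lambda>t. \<Sum>i<n. \<Sum>j<n. cnj (v i) * v j * entry_right_lim \<sigma> i j t"
  let ?G = "\<lambda>t. Re (hform n (\<sigma> t) v v)"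
  let ?q = "\<lambda>t. hform n (density_mat n \<sigma> t) v v"
  note F = trace_mono[OF \<sigma>]
  note [measurable] = hform_density_measurable[OF \<sigma>, of v]
  have lim: "((\<lambda>t. hform n (\<sigma> t) v v) \<longlongrightarrow> ?S t) (at_right t)" for t
    unfolding hform_def
    by (intro tendsto_sum tendsto_mult tendsto_const entry_tendsto(1)[OF \<sigma>]) auto
  have im0: "Im (hform n (\<sigma> t) v v) = 0" for t
    using \<sigma> by (intro Im_hform_hermitian) (auto simp: nondecreasing_mat_fun_def)
  have RG: "right_lim ?G t = Re (?S t)" for t
    by (rule right_lim_eq) (rule tendsto_Re[OF lim])
  \<comment> \<open>Hermitian symmetry of \<open>\<sigma>\<close> survives the passage to right
    limits.\<close>
  have S0: "Im (?S t) = 0" for t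
    using tendsto_Im[OF lim, of t] unfolding im0 by (simp add: tendsto_const_iff)
  have G: "mono ?G"
  proof (rule monoI)
    fix s t :: real assume "s \<le> t"
    then have psd: "psd_mat n (\<sigma> t - \<sigma> s)" and car: "\<sigma> t \<in> carrier_mat n n" "\<sigma> s \<in> carrier_mat n n"
      using \<sigma> by (auto simp: nondecreasing_mat_fun_def)
    have "hform n (\<sigma> t - \<sigma> s) v v = hform n (\<sigma> t) v v - hform n (\<sigma> s) v v"
      using car by (simp add: hform_def right_diff_distrib sum_subtractf)
    with Re_hform_psd[OF psd, of v] show "?G s \<le> ?G t" by simp
  qed
  have re: "has_bochner_integral (trace_measure n \<sigma>) (\<lambda>t. indicator {a<..b} t *\<^sub>R Re (?q t))
      (Re (?S b) - Re (?S a))" if "a \<le> b" for a b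
    using has_bochner_integral_Re[OF hform_density_integral[OF \<sigma> that, of v]] by simp
  have im: "has_bochner_integral (trace_measure n \<sigma>) (\<lambda>t. indicator {a<..b} t *\<^sub>R Im (?q t)) 0"
    if "a \<le> b" for a b
    using has_bochner_integral_Im[OF hform_density_integral[OF \<sigma> that, of v]]
    unfolding minus_complex.sel S0 by simp
  have r0: "right_lim (\<lambda>_. 0::real) t = 0" for t by (rule right_lim_eq) simp
  have "AE t in trace_measure n \<sigma>. 0 \<le> Re (?q t)"
    unfolding trace_measure_def
  proof (rule AE_nonneg_interval_density[OF F G], fold trace_measure_def)
    fix a b :: real assume "a \<le> b"
    from re[OF this] show "set_integrable (trace_measure n \<sigma>) {a<..b} (\<lambda>t. Re (?q t))"
      "set_lebesgue_integral (trace_measure n \<sigma>) {a<..b} (\<lambda>t. Re (?q t)) = right_lim ?G b - right_lim ?G a"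
      unfolding RG has_bochner_integral_iff set_integrable_def set_lebesgue_integral_def by auto
  qed measurable
  \<comment> \<open>Every multiple of the imaginary part is a density of the zero function, which is
    monotone; the multiples by 1 and -1 together force it to vanish.\<close>
  moreover have "AE t in trace_measure n \<sigma>. 0 \<le> c * Im (?q t)" for c
    unfolding trace_measure_def
  proof (rule AE_nonneg_interval_density[OF F, of "\<lambda>_. 0"], fold trace_measure_def)
    fix a b :: real assume "a \<le> b"
    from im[OF this] show "set_integrable (trace_measure n \<sigma>) {a<..b} (\<lambda>t. c * Im (?q t))"
      "set_lebesgue_integral (trace_measure n \<sigma>) {a<..b} (\<lambda>t. c * Im (?q t))
        = right_lim (\<lambda>_. 0) b - right_lim (\<lambda>_. 0) a"
      unfolding r0 has_bochner_integral_iff set_integrable_def set_lebesgue_integral_def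
      by (auto simp: mult.left_commute)
  next
    show "(\<lambda>t. c * Im (?q t)) \<in> borel_measurable borel" by measurable
  qed (simp add: mono_def)
  from this[of 1] this[of "- 1"]
  have "AE t in trace_measure n \<sigma>. Im (?q t) = 0"
    by eventually_elim linarith
  ultimately show ?thesis by eventually_elim auto
qed

text \<open>
  Countably many null sets are removed by testing the form on Gaussian integer vectors only;
  homogeneity and continuity extend the inequality to all vectors.
\<close>

lemma AE_density_psd:
  assumes \<sigma>: "nondecreasing_mat_fun n \<sigma>"
  shows "AE t in trace_measure n \<sigma>. \<forall>v. 0 \<le> Re (hform n (density_mat n \<sigma> t) v v)
    \<and> Im (hform n (density_mat n \<sigma> t) v v) = 0"
proof -
  \<comment> \<open>A pair of integer lists encodes a Gaussian integer vector; lists of integers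
    form a countable type, functions on \<open>nat\<close> do not.\<close>
  have "AE t in trace_measure n \<sigma>. \<forall>(xs :: int list) (ys :: int list).
      0 \<le> Re (hform n (density_mat n \<sigma> t) (\<lambda>i. Complex (of_int (xs ! i)) (of_int (ys ! i)))
        (\<lambda>i. Complex (of_int (xs ! i)) (of_int (ys ! i))))
      \<and> Im (hform n (density_mat n \<sigma> t) (\<lambda>i. Complex (of_int (xs ! i)) (of_int (ys ! i)))
        (\<lambda>i. Complex (of_int (xs ! i)) (of_int (ys ! i)))) = 0"
    unfolding AE_all_countable by (intro allI AE_hform_density_vector[OF \<sigma>])
  then show ?thesis
  proof (rule eventually_mono, intro allI)
    fix t and v :: "nat \<Rightarrow> complex"
    assume *: "\<forall>(xs :: int list) (ys :: int list).
      0 \<le> Re (hform n (density_mat n \<sigma> t) (\<lambda>i. Complex (of_int (xs ! i)) (of_int (ys ! i)))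
        (\<lambda>i. Complex (of_int (xs ! i)) (of_int (ys ! i))))
      \<and> Im (hform n (density_mat n \<sigma> t) (\<lambda>i. Complex (of_int (xs ! i)) (of_int (ys ! i)))
        (\<lambda>i. Complex (of_int (xs ! i)) (of_int (ys ! i)))) = 0"
    let ?M = "density_mat n \<sigma> t"
    define u where "u = (\<lambda>k i. Complex (of_int \<lfloor>real (Suc k) * Re (v i)\<rfloor>) (of_int \<lfloor>real (Suc k) * Im (v i)\<rfloor>))"
    have lim: "(\<lambda>k. hform n ?M (u k) (u k) / of_real ((real (Suc k))\<^sup>2)) \<longlonglongrightarrow> hform n ?M v v"
      unfolding u_def by (rule hform_limit_gaussian)
    have u: "0 \<le> Re (hform n ?M (u k) (u k)) \<and> Im (hform n ?M (u k) (u k)) = 0" for k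
    proof -
      let ?xs = "map (\<lambda>i. \<lfloor>real (Suc k) * Re (v i)\<rfloor>) [0..<n]"
      let ?ys = "map (\<lambda>i. \<lfloor>real (Suc k) * Im (v i)\<rfloor>) [0..<n]"
      have "hform n ?M (u k) (u k) = hform n ?M (\<lambda>i. Complex (of_int (?xs ! i)) (of_int (?ys ! i)))
        (\<lambda>i. Complex (of_int (?xs ! i)) (of_int (?ys ! i)))"
        by (rule hform_cong) (simp_all add: u_def)
      then show ?thesis using *[THEN spec, THEN spec, of ?xs ?ys] by (simp only:)
    qed
    have "0 \<le> Re (hform n ?M v v)"
      by (rule tendsto_lowerbound[OF tendsto_Re[OF lim]])
         (use u in \<open>auto simp: Re_divide_of_real simp del: of_real_power of_nat_Suc\<close>)
    moreover have "Im (hform n ?M v v) = 0"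
      by (rule LIMSEQ_unique[OF tendsto_Im[OF lim]])
         (use u in \<open>simp add: Im_divide_of_real del: of_real_power of_nat_Suc\<close>)
    ultimately show "0 \<le> Re (hform n ?M v v) \<and> Im (hform n ?M v v) = 0" by simp
  qed
qed

section \<open>Vector polynomials\<close>

definition poly_vals :: "(nat \<Rightarrow> complex poly) \<Rightarrow> real \<Rightarrow> nat \<Rightarrow> complex" where
  "poly_vals f t i = poly (f i) (complex_of_real t)"

definition poly_inner ::
  "nat \<Rightarrow> (real \<Rightarrow> complex mat) \<Rightarrow> (nat \<Rightarrow> complex poly) \<Rightarrow> (nat \<Rightarrow> complex poly) \<Rightarrow> complex" where
  "poly_inner n \<sigma> f g =
     integral\<^sup>L (trace_measure n \<sigma>) (\<lambda>t. hform n (density_mat n \<sigma> t) (poly_vals f t) (poly_vals g t))"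

text \<open>The pointwise form of membership in the zero class: almost everywhere the values lie in
  both kernels of the form. Unlike a vanishing integral, this passes at once to multiples by scalar
  polynomials.\<close>

definition null_poly :: "nat \<Rightarrow> (real \<Rightarrow> complex mat) \<Rightarrow> (nat \<Rightarrow> complex poly) \<Rightarrow> bool" where
  "null_poly n \<sigma> f \<longleftrightarrow> (AE t in trace_measure n \<sigma>. \<forall>w.
     hform n (density_mat n \<sigma> t) (poly_vals f t) w = 0 \<and>
     hform n (density_mat n \<sigma> t) w (poly_vals f t) = 0)"

lemma L2_inner_eq_poly_inner:
  assumes \<sigma>: "nondecreasing_mat_fun n \<sigma>" and fg: "f \<in> carrier_vec n" "g \<in> carrier_vec n"
  shows "L2_inner n \<sigma> (eval_vec f) (eval_vec g) = poly_inner n \<sigma> (($) f) (($) g)"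
proof -
  have "(density_mat n \<sigma> t *\<^sub>v eval_vec g t) \<bullet>c eval_vec f t
      = hform n (density_mat n \<sigma> t) (poly_vals (($) f) t) (poly_vals (($) g) t)" for t
  proof -
    have "(density_mat n \<sigma> t *\<^sub>v eval_vec g t) \<bullet>c eval_vec f t
        = hform n (density_mat n \<sigma> t) (($) (eval_vec f t)) (($) (eval_vec g t))"
      by (rule hform_eq_cscalar_prod) (use fg density_mat_carrier[OF \<sigma>] in \<open>auto simp: eval_vec_def\<close>)
    also have "\<dots> = hform n (density_mat n \<sigma> t) (poly_vals (($) f) t) (poly_vals (($) g) t)"
      by (rule hform_cong) (use fg in \<open>auto simp: eval_vec_def poly_vals_def\<close>)
    finally show ?thesis .
  qed
  then show ?thesis by (simp add: L2_inner_def poly_inner_def)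
qed

text \<open>Expanding both polynomials into monomials leaves finitely many moments of the entries of
  the density.\<close>

lemma integrable_hform_poly:
  assumes mom: "finite_moments n \<sigma>"
  shows "integrable (trace_measure n \<sigma>)
    (\<lambda>t. hform n (density_mat n \<sigma> t) (poly_vals f t) (poly_vals g t))"
proof -
  have "integrable (trace_measure n \<sigma>)
      (\<lambda>t. cnj (poly_vals f t i) * poly_vals g t j * density_mat n \<sigma> t $$ (i, j))"
    if ij: "i < n" "j < n" for i j
  proof -
    have "integrable (trace_measure n \<sigma>) (\<lambda>t. \<Sum>a\<le>degree (f i). \<Sum>b\<le>degree (g j).
        (cnj (coeff (f i) a) * coeff (g j) b) * (complex_of_real (t ^ (a + b)) * density_mat n \<sigma> t $$ (i, j)))"
      by (intro Bochner_Integration.integrable_sum integrable_mult_right) (use mom ij in \<open>simp add: finite_moments_def\<close>)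
    also have "(\<lambda>t. \<Sum>a\<le>degree (f i). \<Sum>b\<le>degree (g j).
        (cnj (coeff (f i) a) * coeff (g j) b) * (complex_of_real (t ^ (a + b)) * density_mat n \<sigma> t $$ (i, j)))
      = (\<lambda>t. cnj (poly_vals f t i) * poly_vals g t j * density_mat n \<sigma> t $$ (i, j))"
      by (simp add: poly_vals_def poly_altdef sum_distrib_left sum_distrib_right power_add ac_simps)
    finally show ?thesis .
  qed
  then show ?thesis unfolding hform_def by (intro Bochner_Integration.integrable_sum) auto
qed

text \<open>A nonnegative integrand with zero integral vanishes almost everywhere;
  \<open>psd_form_null\<close> then applies at each such point.\<close>

lemma poly_inner_zero_imp_null:
  assumes \<sigma>: "nondecreasing_mat_fun n \<sigma>" and mom: "finite_moments n \<sigma>"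
    and zero: "poly_inner n \<sigma> f f = 0"
  shows "null_poly n \<sigma> f"
proof -
  let ?q = "\<lambda>t. hform n (density_mat n \<sigma> t) (poly_vals f t) (poly_vals f t)"
  note int = integrable_hform_poly[OF mom, of f f]
  have "integral\<^sup>L (trace_measure n \<sigma>) (\<lambda>t. Re (?q t)) = 0"
    using zero integral_Re[OF int] by (simp add: poly_inner_def)
  moreover have "AE t in trace_measure n \<sigma>. 0 \<le> Re (?q t)"
    using AE_density_psd[OF \<sigma>] by eventually_elim auto
  ultimately have "AE t in trace_measure n \<sigma>. Re (?q t) = 0"
    using integral_nonneg_eq_0_iff_AE[OF integrable_Re[OF int]] by simp
  then show ?thesis
    unfolding null_poly_def using AE_density_psd[OF \<sigma>]
  proof eventually_elim
    case (elim t)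
    then have "?q t = 0" by (simp add: complex_eq_iff)
    with elim(2) psd_form_null[of n "density_mat n \<sigma> t" "poly_vals f t"] show ?case by blast
  qed
qed

text \<open>At a fixed \<open>t\<close> the polynomial coefficients are numbers, and the kernels are
  linear subspaces. Finiteness of \<open>J\<close> gives one common null set.\<close>

lemma null_poly_combination:
  assumes "\<And>j. j \<in> J \<Longrightarrow> null_poly n \<sigma> (f j)" and J: "finite J"
  shows "null_poly n \<sigma> (\<lambda>i. \<Sum>j\<in>J. R j * f j i)"
proof -
  have "AE t in trace_measure n \<sigma>. \<forall>j\<in>J. \<forall>w.
     hform n (density_mat n \<sigma> t) (poly_vals (f j) t) w = 0 \<and>
     hform n (density_mat n \<sigma> t) w (poly_vals (f j) t) = 0"
    using assms by (intro AE_finite_allI) (auto simp: null_poly_def)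
  then show ?thesis
    unfolding null_poly_def
  proof eventually_elim
    case (elim t)
    have "poly_vals (\<lambda>i. \<Sum>j\<in>J. R j * f j i) t
        = (\<lambda>i. \<Sum>j\<in>J. poly (R j) (complex_of_real t) * poly_vals (f j) t i)"
      by (simp add: poly_vals_def fun_eq_iff poly_sum)
    with elim show ?case
      by (simp add: hform_sum_left hform_sum_right hform_scale_left hform_scale_right)
  qed
qed

text \<open>The two cross terms and the square of \<open>s\<close> vanish almost everywhere.\<close>

lemma poly_inner_add_null:
  assumes mom: "finite_moments n \<sigma>" and s: "null_poly n \<sigma> s" and r: "\<And>i. i < n \<Longrightarrow> r i = f i + s i"
  shows "poly_inner n \<sigma> r r = poly_inner n \<sigma> f f"
  unfolding poly_inner_def
proof (rule integral_cong_AE)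
  show "AE t in trace_measure n \<sigma>. hform n (density_mat n \<sigma> t) (poly_vals r t) (poly_vals r t)
      = hform n (density_mat n \<sigma> t) (poly_vals f t) (poly_vals f t)"
    using s unfolding null_poly_def
  proof eventually_elim
    case (elim t)
    let ?h = "hform n (density_mat n \<sigma> t)"
    have "?h (poly_vals r t) (poly_vals r t)
        = ?h (\<lambda>i. poly_vals f t i + poly_vals s t i) (\<lambda>i. poly_vals f t i + poly_vals s t i)"
      by (rule hform_cong) (simp_all add: r poly_vals_def)
    with elim show ?case by (simp add: hform_add_left hform_add_right)
  qed
qed (intro borel_measurable_integrable integrable_hform_poly[OF mom])+

text \<open>Pythagoras, by sesquilinear expansion under the integral.\<close>

lemma poly_inner_orthonormal_combination:
  assumes mom: "finite_moments n \<sigma>" and K: "finite K"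
    and orth: "\<And>k l. k \<in> K \<Longrightarrow> l \<in> K \<Longrightarrow> poly_inner n \<sigma> (f k) (f l) = (if k = l then 1 else 0)"
  shows "poly_inner n \<sigma> (\<lambda>i. \<Sum>k\<in>K. Polynomial.smult (a k) (f k i)) (\<lambda>i. \<Sum>k\<in>K. Polynomial.smult (a k) (f k i))
    = of_real (\<Sum>k\<in>K. (cmod (a k))\<^sup>2)"
proof -
  let ?h = "\<lambda>t. hform n (density_mat n \<sigma> t)"
  have "poly_vals (\<lambda>i. \<Sum>k\<in>K. Polynomial.smult (a k) (f k i)) t = (\<lambda>i. \<Sum>k\<in>K. a k * poly_vals (f k) t i)" for t
    by (simp add: poly_vals_def fun_eq_iff poly_sum)
  then have "poly_inner n \<sigma> (\<lambda>i. \<Sum>k\<in>K. Polynomial.smult (a k) (f k i)) (\<lambda>i. \<Sum>k\<in>K. Polynomial.smult (a k) (f k i))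
      = integral\<^sup>L (trace_measure n \<sigma>)
          (\<lambda>t. \<Sum>k\<in>K. \<Sum>l\<in>K. (cnj (a k) * a l) * ?h t (poly_vals (f k) t) (poly_vals (f l) t))"
    by (simp add: poly_inner_def hform_sum_left hform_sum_right hform_scale_left hform_scale_right
        sum_distrib_left mult.assoc)
  also have "\<dots> = (\<Sum>k\<in>K. \<Sum>l\<in>K. (cnj (a k) * a l) * poly_inner n \<sigma> (f k) (f l))"
    by (subst Bochner_Integration.integral_sum,
        (intro Bochner_Integration.integrable_sum integrable_mult_right integrable_hform_poly[OF mom]))
       (simp add: poly_inner_def integrable_hform_poly[OF mom])
  also have "\<dots> = (\<Sum>k\<in>K. \<Sum>l\<in>K. if k = l then cnj (a k) * a k else 0)"
    by (intro sum.cong refl) (simp add: orth)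
  also have "\<dots> = (\<Sum>k\<in>K. of_real ((cmod (a k))\<^sup>2))"
    using K by (simp add: complex_norm_square mult.commute del: of_real_power)
  finally show ?thesis by simp
qed

section \<open>The span of the \<open>p k\<close> and the polynomial multiples of the
  \<open>q j\<close>\<close>

text \<open>The coefficients \<open>a k\<close> are constants, as Pythagoras requires, whereas the
  \<open>R j\<close> are arbitrary polynomials, which nullity of the \<open>q j\<close>
  permits.\<close>

definition generated ::
  "nat \<Rightarrow> nat \<Rightarrow> (nat \<Rightarrow> nat \<Rightarrow> complex poly) \<Rightarrow> (nat \<Rightarrow> nat \<Rightarrow> complex poly) \<Rightarrow> (nat \<Rightarrow> complex poly) \<Rightarrow> bool" where
  "generated n j0 p q r \<longleftrightarrow> (\<exists>K a R. \<forall>c<n.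
     r c = (\<Sum>k=1..K. Polynomial.smult (a k) (p k c)) + (\<Sum>j=1..j0. R j * q j c))"

lemma generated_cong:
  "(\<And>c. c < n \<Longrightarrow> r c = r' c) \<Longrightarrow> generated n j0 p q r = generated n j0 p q r'"
  by (simp add: generated_def)

lemma generated_zero: "generated n j0 p q (\<lambda>c. 0)"
  unfolding generated_def by (intro exI[of _ 0] exI[of _ "\<lambda>_. 0"]) simp

lemma generated_p:
  assumes "k \<ge> 1"
  shows "generated n j0 p q (p k)"
proof -
  have "p k c = (\<Sum>l=1..k. Polynomial.smult (if l = k then 1 else 0) (p l c))
      + (\<Sum>j=1..j0. (\<lambda>_. 0) j * q j c)" for c
    using assms by (simp add: if_distrib[of "\<lambda>x. Polynomial.smult x _"] cong: if_cong)
  then show ?thesis unfolding generated_def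
    by (intro exI[of _ k] exI[of _ "\<lambda>l. if l = k then 1 else 0"] exI[of _ "\<lambda>_. 0"]) blast
qed

lemma generated_q:
  assumes "j \<in> {1..j0}"
  shows "generated n j0 p q (\<lambda>c. R * q j c)"
proof -
  have "R * q j c = (\<Sum>l=1..0. Polynomial.smult ((\<lambda>_. 0) l) (p l c))
      + (\<Sum>i=1..j0. (if i = j then R else 0) * q i c)" for c
    using assms by (simp add: if_distrib[of "\<lambda>x. x * _"] cong: if_cong)
  then show ?thesis unfolding generated_def
    by (intro exI[of _ 0] exI[of _ "\<lambda>_. 0"] exI[of _ "\<lambda>i. if i = j then R else 0"]) blast
qed

lemma generated_add:
  assumes "generated n j0 p q r" "generated n j0 p q s"
  shows "generated n j0 p q (\<lambda>c. r c + s c)"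
proof -
  obtain K a R where r: "\<And>c. c < n \<Longrightarrow> r c = (\<Sum>k=1..K. Polynomial.smult (a k) (p k c)) + (\<Sum>j=1..j0. R j * q j c)"
    using assms(1) unfolding generated_def by blast
  obtain L b S where s: "\<And>c. c < n \<Longrightarrow> s c = (\<Sum>k=1..L. Polynomial.smult (b k) (p k c)) + (\<Sum>j=1..j0. S j * q j c)"
    using assms(2) unfolding generated_def by blast
  \<comment> \<open>The shorter combination is padded with zero coefficients to the common
    length.\<close>
  have extend: "(\<Sum>k=1..K. Polynomial.smult (a k) (p k c))
      = (\<Sum>k=1..max K L. Polynomial.smult (if k \<le> K then a k else 0) (p k c))"
    for K L a c
    by (rule sum.mono_neutral_cong_left) auto
  have "r c + s c = (\<Sum>k=1..max K L. Polynomial.smult ((if k \<le> K then a k else 0) + (if k \<le> L then b k else 0)) (p k c))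
      + (\<Sum>j=1..j0. (R j + S j) * q j c)" if "c < n" for c
    unfolding r[OF that] s[OF that] extend[of a c K L] extend[of b c L K]
    by (simp add: smult_add_left sum.distrib max.commute algebra_simps)
  then show ?thesis unfolding generated_def
    by (intro exI[of _ "max K L"] exI[of _ "\<lambda>k. (if k \<le> K then a k else 0) + (if k \<le> L then b k else 0)"]
        exI[of _ "\<lambda>j. R j + S j"]) blast
qed

lemma generated_smult:
  assumes "generated n j0 p q r"
  shows "generated n j0 p q (\<lambda>c. Polynomial.smult x (r c))"
proof -
  obtain K a R where r: "\<And>c. c < n \<Longrightarrow> r c = (\<Sum>k=1..K. Polynomial.smult (a k) (p k c)) + (\<Sum>j=1..j0. R j * q j c)"
    using assms unfolding generated_def by blast
  have "Polynomial.smult x (r c) = (\<Sum>k=1..K. Polynomial.smult (x * a k) (p k c)) + (\<Sum>j=1..j0. Polynomial.smult x (R j) * q j c)"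
    if "c < n" for c
    by (simp add: r[OF that] smult_add_right smult_sum2)
  then show ?thesis unfolding generated_def
    by (intro exI[of _ K] exI[of _ "\<lambda>k. x * a k"] exI[of _ "\<lambda>j. Polynomial.smult x (R j)"]) blast
qed

lemma generated_sum:
  assumes "\<And>i. i \<in> I \<Longrightarrow> generated n j0 p q (r i)"
  shows "generated n j0 p q (\<lambda>c. \<Sum>i\<in>I. r i c)"
  using assms
  by (induction I rule: infinite_finite_induct) (auto intro: generated_zero generated_add)

text \<open>On the \<open>q\<close> part the factor is absorbed into \<open>R j\<close>; on the
  \<open>p\<close> part it would leave the constant coefficients, which is where the hypothesis on
  \<open>poly_z * p k\<close> enters.\<close>

lemma generated_mult_z:
  assumes z: "\<And>k. k \<ge> 1 \<Longrightarrow> generated n j0 p q (\<lambda>c. poly_z * p k c)"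
    and "generated n j0 p q r"
  shows "generated n j0 p q (\<lambda>c. poly_z * r c)"
proof -
  obtain K a R where r: "\<And>c. c < n \<Longrightarrow> r c = (\<Sum>k=1..K. Polynomial.smult (a k) (p k c)) + (\<Sum>j=1..j0. R j * q j c)"
    using assms(2) unfolding generated_def by blast
  have "generated n j0 p q (\<lambda>c. (\<Sum>k=1..K. Polynomial.smult (a k) (poly_z * p k c)) + (\<Sum>j=1..j0. (poly_z * R j) * q j c))"
    by (intro generated_add generated_sum generated_smult generated_q z) auto
  then show ?thesis
    by (rule generated_cong[THEN iffD1, rotated])
       (simp only: r distrib_left sum_distrib_left mult_smult_right mult.assoc)
qed

text \<open>Horner's scheme: \<open>pCons x P\<close> is \<open>x\<close> plus
  \<open>poly_z * P\<close>.\<close>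

lemma generated_mult_poly:
  assumes z: "\<And>k. k \<ge> 1 \<Longrightarrow> generated n j0 p q (\<lambda>c. poly_z * p k c)"
    and r: "generated n j0 p q r"
  shows "generated n j0 p q (\<lambda>c. P * r c)"
proof (induction P)
  case 0
  then show ?case by (simp add: generated_zero)
next
  case (pCons x P)
  have "generated n j0 p q (\<lambda>c. Polynomial.smult x (r c) + poly_z * (P * r c))"
    by (intro generated_add generated_smult r generated_mult_z[OF z] pCons.IH)
  then show ?case by simp
qed

text \<open>Closure under polynomial multiples reduces the claim to the constant basis vectors,
  which are recovered from the columns of the triangular matrix \<open>T\<close>.\<close>

lemma generated_all:
  assumes z: "\<And>k. k \<ge> 1 \<Longrightarrow> generated n j0 p q (\<lambda>c. poly_z * p k c)"
    and T: "initial_matrix n T"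
    and p: "\<And>k c. k < n \<Longrightarrow> c < n \<Longrightarrow> p (Suc k) c = real_const (T $$ (c, k))"
  shows "generated n j0 p q r"
proof -
  have unit: "generated n j0 p q (\<lambda>c. if c = i then 1 else 0)" if "i < n" for i
    using that
  proof (induction i rule: less_induct)
    case (less i)
    \<comment> \<open>Forward substitution: the \<open>i\<close>-th column of \<open>T\<close>
      involves only basis vectors up to \<open>i\<close>, and its diagonal entry is nonzero. The
      column is \<open>p (Suc i)\<close>, since \<open>p\<close> is numbered from 1.\<close>
    have "generated n j0 p q (\<lambda>c. Polynomial.smult (1 / complex_of_real (T $$ (i, i)))
        (p (Suc i) c + (\<Sum>l<i. Polynomial.smult (- complex_of_real (T $$ (l, i))) (if c = l then 1 else 0))))"
      by (intro generated_smult generated_add generated_sum generated_p less.IH) (use less.prems in auto)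
    then show ?case
    proof (rule generated_cong[THEN iffD1, rotated])
      fix c assume c: "c < n"
      have T': "T $$ (i, i) \<noteq> 0" "i < c \<Longrightarrow> T $$ (c, i) = 0"
        using T less.prems c by (auto simp: initial_matrix_def upper_triangular_def)
      have "(\<Sum>l<i. Polynomial.smult (- complex_of_real (T $$ (l, i))) (if c = l then 1 else 0))
          = (\<Sum>l<i. if l = c then - real_const (T $$ (c, i)) else 0)"
        by (intro sum.cong) auto
      also have "\<dots> = (if c < i then - real_const (T $$ (c, i)) else 0)" by simp
      finally show "Polynomial.smult (1 / complex_of_real (T $$ (i, i)))
        (p (Suc i) c + (\<Sum>l<i. Polynomial.smult (- complex_of_real (T $$ (l, i))) (if c = l then 1 else 0)))
        = (if c = i then 1 else 0)"
        using T' less.prems c by (auto simp: p one_pCons)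
    qed
  qed
  have "generated n j0 p q (\<lambda>c. \<Sum>i<n. r i * (if c = i then 1 else 0))"
    by (intro generated_sum generated_mult_poly[OF z] unit) auto
  then show ?thesis
    by (rule generated_cong[THEN iffD1, rotated]) (simp add: if_distrib cong: if_cong)
qed

text \<open>Away from the degenerations the recurrence itself expresses the product; at
  \<open>m j\<close> the definition of \<open>q_poly\<close> is solved for it.\<close>

lemma generated_recurrence:
  assumes p: "vector_polynomials n A j0 m T p" and k: "k \<ge> 1"
  shows "generated n j0 (\<lambda>k. ($) (p k)) (\<lambda>j. ($) (q_poly n A m p j)) (\<lambda>c. poly_z * p k $ c)"
proof -
  let ?gen = "generated n j0 (\<lambda>k. ($) (p k)) (\<lambda>j. ($) (q_poly n A m p j))"
  have 0: "?gen (($) (p l))" for l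
  \<comment> \<open>Index 0 arises from the truncated subtraction \<open>k + i - n\<close>; there
    \<open>p\<close> is zero, while the span starts at index 1.\<close>
  proof (cases "l = 0")
    case True
    have "?gen (\<lambda>c. 0)" by (rule generated_zero)
    then show ?thesis
      by (rule generated_cong[THEN iffD1, rotated]) (use p True in \<open>simp add: vector_polynomials_def\<close>)
  next
    case False
    then show ?thesis using generated_p[of l n j0 "\<lambda>k. ($) (p k)"] by simp
  qed
  have *: "?gen (\<lambda>c. real_const x * p l $ c)" for x l
    using generated_smult[OF 0[of l], of "complex_of_real x"] by simp
  show ?thesis
  proof (cases "k \<in> m ` {1..j0}")
    case False
    have "?gen (\<lambda>c. (\<Sum>i=0..<n. real_const (diag A (n - i) (k + i - n)) * p (k + i - n) $ c)
           + real_const (diag A 0 k) * p k $ c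
           + (\<Sum>i=1..n. real_const (diag A i k) * p (k + i) $ c))"
      by (intro generated_add generated_sum *)
    then show ?thesis
      by (rule generated_cong[THEN iffD1, rotated]) (rule p[unfolded vector_polynomials_def, THEN conjunct2, THEN conjunct2, THEN conjunct2,
          rule_format, OF k False])
  next
    case True
    then obtain j where j: "j \<in> {1..j0}" "k = m j" by auto
    \<comment> \<open>The factor 1 gives the \<open>q\<close> term the shape required by
      \<open>generated_q\<close>.\<close>
    have "?gen (\<lambda>c. 1 * q_poly n A m p j $ c + (real_const (diag A 0 k) * p k $ c
         + ((\<Sum>i=0..<n. real_const (diag A (n - i) (k + i - n)) * p (k + i - n) $ c)
           + (\<Sum>i=1..n - j. real_const (diag A i k) * p (k + i) $ c))))"
      by (intro generated_add generated_sum * generated_q j(1))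
    then show ?thesis
      by (rule generated_cong[THEN iffD1, rotated]) (simp add: q_poly_def j(2) algebra_simps)
  qed
qed

section \<open>Null vector polynomials\<close>

lemma null_vector_polynomial:
  assumes spec: "spectral_function n A j0 m \<sigma> T p" and r: "r \<in> carrier_vec n"
    and zero: "L2_inner n \<sigma> (eval_vec r) (eval_vec r) = 0"
  shows "\<exists>R. r = Matrix.vec n (\<lambda>c. \<Sum>j=1..j0. R j * q_poly n A m p j $ c)"
proof -
  let ?q = "\<lambda>j. ($) (q_poly n A m p j)" and ?p = "\<lambda>k. ($) (p k)"
  have \<sigma>: "nondecreasing_mat_fun n \<sigma>" and mom: "finite_moments n \<sigma>" and T: "initial_matrix n T"
    and p: "vector_polynomials n A j0 m T p"
    using spec by (auto simp: spectral_function_def)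
  have pc: "p k \<in> carrier_vec n" for k using p by (simp add: vector_polynomials_def)
  have orth: "poly_inner n \<sigma> (?p k) (?p l) = (if k = l then 1 else 0)" if "k \<ge> 1" "l \<ge> 1" for k l
    using spec that L2_inner_eq_poly_inner[OF \<sigma> pc pc, of k l] by (simp add: spectral_function_def)
  have qnull: "null_poly n \<sigma> (?q j)" if "j \<in> {1..j0}" for j
  proof (rule poly_inner_zero_imp_null[OF \<sigma> mom])
    have "q_poly n A m p j \<in> carrier_vec n" by (simp add: q_poly_def)
    then show "poly_inner n \<sigma> (?q j) (?q j) = 0"
      using spec that L2_inner_eq_poly_inner[OF \<sigma>, of "q_poly n A m p j" "q_poly n A m p j"]
      by (simp add: spectral_function_def L2_zero_class_def)
  qed
  have "generated n j0 ?p ?q (($) r)"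
  proof (rule generated_all[OF generated_recurrence[OF p] T])
    fix k c assume "k < n" "c < n"
    then show "p (Suc k) $ c = real_const (T $$ (c, k))"
      using p T by (auto simp: vector_polynomials_def initial_matrix_def)
  qed
  then obtain K a R where rep: "\<And>c. c < n \<Longrightarrow>
      r $ c = (\<Sum>k=1..K. Polynomial.smult (a k) (p k $ c)) + (\<Sum>j=1..j0. R j * q_poly n A m p j $ c)"
    unfolding generated_def by blast
  have "null_poly n \<sigma> (\<lambda>c. \<Sum>j=1..j0. R j * ?q j c)"
    by (rule null_poly_combination) (use qnull in auto)
  \<comment> \<open>The \<open>q\<close> part drops out of the norm, so only the orthonormal part
    remains.\<close>
  from poly_inner_add_null[OF mom this rep]
  have "poly_inner n \<sigma> (($) r) (($) r)
      = poly_inner n \<sigma> (\<lambda>c. \<Sum>k=1..K. Polynomial.smult (a k) (?p k c)) (\<lambda>c. \<Sum>k=1..K. Polynomial.smult (a k) (?p k c))" .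
  also have "\<dots> = of_real (\<Sum>k=1..K. (cmod (a k))\<^sup>2)"
    by (rule poly_inner_orthonormal_combination[OF mom]) (use orth in auto)
  finally have "of_real (\<Sum>k=1..K. (cmod (a k))\<^sup>2) = (0::complex)"
    using zero L2_inner_eq_poly_inner[OF \<sigma> r r] by simp
  then have "(\<Sum>k=1..K. (cmod (a k))\<^sup>2) = 0" by (simp only: of_real_eq_0_iff)
  then have "\<forall>k\<in>{1..K}. a k = 0"
    by (subst (asm) sum_nonneg_eq_0_iff) auto
  then have "r $ c = (\<Sum>j=1..j0. R j * q_poly n A m p j $ c)" if "c < n" for c
    using rep[OF that] by simp
  then have "r = Matrix.vec n (\<lambda>c. \<Sum>j=1..j0. R j * q_poly n A m p j $ c)"
    using r by (intro eq_vecI) auto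
  then show ?thesis by blast
qed

theorem theorem3p1:
  fixes n j0 :: nat
    and A :: "nat \<Rightarrow> nat \<Rightarrow> real"
    and m :: "nat \<Rightarrow> nat"
    and \<sigma> :: "real \<Rightarrow> complex mat"
    and T :: "real mat"
    and p :: "nat \<Rightarrow> complex poly Matrix.vec"
  assumes "band_class n A j0 m"
    and "spectral_function n A j0 m \<sigma> T p"
  shows
    "(j0 = 0 \<longrightarrow>
        (\<forall>r\<in>carrier_vec n. L2_inner n \<sigma> (eval_vec r) (eval_vec r) = 0 \<longleftrightarrow> r = 0\<^sub>v n)) \<and>
     (j0 > 0 \<longrightarrow>
        (\<forall>j\<in>{1..j0}. eval_vec (q_poly n A m p j) \<in> L2_zero_class n \<sigma>) \<and>
        (\<forall>r\<in>carrier_vec n. eval_vec r \<in> L2_zero_class n \<sigma> \<longrightarrow>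
           (\<exists>R :: nat \<Rightarrow> complex poly.
              r = Matrix.vec n (\<lambda>c. \<Sum>j=1..j0. R j * q_poly n A m p j $ c))))"
proof (intro conjI impI ballI iffI)
  have \<sigma>: "nondecreasing_mat_fun n \<sigma>" using assms(2) by (simp add: spectral_function_def)
  note null = null_vector_polynomial[OF assms(2)]
  fix r :: "complex poly Matrix.vec"
  assume r: "r \<in> carrier_vec n"
  show "r = 0\<^sub>v n" if "j0 = 0" "L2_inner n \<sigma> (eval_vec r) (eval_vec r) = 0"
    \<comment> \<open>For \<open>j0 = 0\<close> the representing sum is empty.\<close>
    using null[OF r that(2)] that(1) by (auto simp: vec_eq_iff)
  show "L2_inner n \<sigma> (eval_vec r) (eval_vec r) = 0" if "r = 0\<^sub>v n"
  proof -
    have "hform n B (poly_vals (($) (0\<^sub>v n)) t) (poly_vals (($) (0\<^sub>v n)) t) = 0" for B t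
      by (simp add: hform_def poly_vals_def)
    then show ?thesis
      using L2_inner_eq_poly_inner[OF \<sigma> r r] that by (simp add: poly_inner_def)
  qed
  show "\<exists>R. r = Matrix.vec n (\<lambda>c. \<Sum>j=1..j0. R j * q_poly n A m p j $ c)"
    if "eval_vec r \<in> L2_zero_class n \<sigma>"
    using null[OF r] that by (simp add: L2_zero_class_def)
next
  fix j assume "j \<in> {1..j0}"
  then show "eval_vec (q_poly n A m p j) \<in> L2_zero_class n \<sigma>"
    using assms(2) by (simp add: spectral_function_def)
qed

end
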